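(* Let $U=U_1\times\cdots\times U_m$ be a Cartesian product of nonempty finite sets. For a set $S\subseteq U$, the following conditions are equivalent: (1) $S$ is ample; (2) $S^M$ is isometric for all $M\in\mathrm{MProd}(U)$ (superisometricity); (3) $S$ is box-superisometric; (4) $S^M$ is connected for all $M\in\mathrm{MProd}(U)$ (superconnectivity); (5) $(S^M)_{M'}=(S_{M'})^M$ for all $M,M'\in\mathrm{MProd}(U)$ with disjoint supports (commutativity); (6) $S^*=U\setminus S$ is ample.
   Context: A box of $U$ is a set $B=B_1\times\cdots\times B_m$ with $\varnothing\ne B_i\subseteq U_i$. A generalized partition of $U$ is a tuple $\Lambda=(\alpha_1,\dots,\alpha_m)$ with $\alpha_i$ a partition of $U_i$ into nonempty blocks. It defines a partition of $U$ into the boxes $P^1\times\cdots\times P^m$, $P^i\in\alpha_i$, and the minor-subproduct $M=M(\Lambda)=M_1\times\cdots\times M_m$, where $M_i$ is the set of blocks of $\alpha_i$; elements of $M$ are identified with the boxes of the box-partition. $\mathrm{MProd}(U)$ is the set of all minor-subproducts of $U$. The support $\mathrm{supp}(M)$ is the set of $i$ such that $\alpha_i$ has a non-singleton block. $U$ itself is identified with the minor-subproduct all of whose blocks are singletons. $M(\Lambda)$ is shattered by $S\subseteq U$ if $S$ meets every box of the box-partition of $\Lambda$. A copy of $M(\Lambda)$ is a set $W_1\times\cdots\times W_m$ where $W_i$ consists of exactly one element from each block of $\alpha_i$. $M(\Lambda)$ is strongly shattered by $S$ if $S$ contains a copy of it. $S$ is ample if every $M\in\mathrm{MProd}(U)$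 shattered by $S$ is strongly shattered by $S$. For $M=M(\Lambda),M'=M(\Lambda')$, let $M\vee M'$ be the minor-subproduct of the generalized partition whose $i$-th component is the join (finest common coarsening) of the $i$-th components of $\Lambda$ and $\Lambda'$. If $N$ is a minor-subproduct whose partitions coarsen those of $M'$ and $t\in N$, let $F_{M'}(t)$ be the set of elements (boxes) of $M'$ contained in the box $t$. For $S\subseteq M'$ and any $M\in \mathrm{MProd}(U)$ define $S_M=\{t\in M\vee M': F_{M'}(t)\cap S\ne\varnothing\}$ and $S^M=\{t\in M\vee M': F_{M'}(t)\subseteq S\}$. In particular, for $S\subseteq U$, $S_M$ and $S^M$ are the sets of $t\in M$ whose boxes meet $S$, respectively are contained in $S$. The Hamming graph of a product (of $U$, or of $M=M_1\times\cdots\times M_m$) has the tuples as vertices, two being adjacent iff they differ in exactly one coordinate; the distance is the number of differing coordinates. A subset of the product is connected if it induces a connected subgraph, and isometric if any two of its elements are joined by a path inside the subset whose length equals their Hamming distance (the empty set counts as connected and isometric). $S^M$ is viewed as a subset of $M$. Two boxes $B',B''$ are parallel if for each $i$ either $B'_i=B''_i$, or $|B'_i|=|B''_i|=1$; that is, $B'=V\times t'$ and $B''=V\times t''$ for a common product $V$ over a set $A$ of coordinates and $(X\setminus A)$-tuples $t',t''$, where $X=\{1,\dots,m\}$. A gallery of length $\ell$ between them is a sequence $B'=B_0,B_1,\dots,B_\ell=B''$ of boxes $B_j=V\times t_j$ such that $t_j,t_{j+1}$ differ in exactly one coordinate; it is geodesic if $\ell$ equals the Hamming distance between $t'$ and $t''$.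 $S$ is box-superisometric if any two parallel boxes $B',B''\subseteq S$ are joined by a geodesic gallery all of whose boxes are contained in $S$. *)

theory Defs
  imports "HOL-Library.FuncSet" "HOL-Library.Disjoint_Sets"
begin

text \<open>
  Products are sets of extensional functions on an index set \<open>I\<close>. A minor-subproduct is represented
  by its generalized partition \<open>\<Lambda>\<close>, which it determines because all factors \<open>U i\<close> are nonempty; its
  elements are the tuples of blocks \<open>t \<in> PiE I \<Lambda>\<close>, and \<open>t\<close> is identified with the box \<open>PiE I t\<close>.
\<close>

definition boxes :: "'i set \<Rightarrow> ('i \<Rightarrow> 'a set) \<Rightarrow> ('i \<Rightarrow> 'a set) set" where
  "boxes I U = (\<Pi>\<^sub>E i\<in>I. Pow (U i) - {{}})"

definition MProd :: "'i set \<Rightarrow> ('i \<Rightarrow> 'a set) \<Rightarrow> ('i \<Rightarrow> 'a set set) set" where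
  "MProd I U = (\<Pi>\<^sub>E i\<in>I. {\<alpha>. partition_on (U i) \<alpha>})"

definition minor_subproduct :: "'i set \<Rightarrow> ('i \<Rightarrow> 'a set set) \<Rightarrow> ('i \<Rightarrow> 'a set) set" where
  "minor_subproduct I \<Lambda> = (\<Pi>\<^sub>E i\<in>I. \<Lambda> i)"

definition support :: "'i set \<Rightarrow> ('i \<Rightarrow> 'a set set) \<Rightarrow> 'i set" where
  "support I \<Lambda> = {i \<in> I. \<exists>B\<in>\<Lambda> i. \<not> is_singleton B}"

definition singleton_partition :: "'i set \<Rightarrow> ('i \<Rightarrow> 'a set) \<Rightarrow> ('i \<Rightarrow> 'a set set)" where
  "singleton_partition I U = (\<lambda>i\<in>I. (\<lambda>x. {x}) ` U i)"

text \<open>The identification of subsets of \<open>U\<close> with subsets of the minor-subproduct all of whose blocks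
  are singletons.\<close>

definition singleton_boxes :: "'i set \<Rightarrow> ('i \<Rightarrow> 'a) set \<Rightarrow> ('i \<Rightarrow> 'a set) set" where
  "singleton_boxes I S = (\<lambda>x. \<lambda>i\<in>I. {x i}) ` S"


definition shattered :: "'i set \<Rightarrow> ('i \<Rightarrow> 'a) set \<Rightarrow> ('i \<Rightarrow> 'a set set) \<Rightarrow> bool" where
  "shattered I S \<Lambda> \<longleftrightarrow> (\<forall>t\<in>minor_subproduct I \<Lambda>. S \<inter> PiE I t \<noteq> {})"

definition is_copy ::
  "'i set \<Rightarrow> ('i \<Rightarrow> 'a set) \<Rightarrow> ('i \<Rightarrow> 'a set set) \<Rightarrow> ('i \<Rightarrow> 'a) set \<Rightarrow> bool" where
  "is_copy I U \<Lambda> C \<longleftrightarrow>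
     (\<exists>W. C = PiE I W \<and> (\<forall>i\<in>I. W i \<subseteq> U i \<and> (\<forall>B\<in>\<Lambda> i. \<exists>!x. x \<in> W i \<and> x \<in> B)))"

definition strongly_shattered ::
  "'i set \<Rightarrow> ('i \<Rightarrow> 'a set) \<Rightarrow> ('i \<Rightarrow> 'a) set \<Rightarrow> ('i \<Rightarrow> 'a set set) \<Rightarrow> bool" where
  "strongly_shattered I U S \<Lambda> \<longleftrightarrow> (\<exists>C. is_copy I U \<Lambda> C \<and> C \<subseteq> S)"

definition ample :: "'i set \<Rightarrow> ('i \<Rightarrow> 'a set) \<Rightarrow> ('i \<Rightarrow> 'a) set \<Rightarrow> bool" where
  "ample I U S \<longleftrightarrow> (\<forall>\<Lambda>\<in>MProd I U. shattered I S \<Lambda> \<longrightarrow> strongly_shattered I U S \<Lambda>)"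


definition is_finest_common_coarsening ::
  "'a set \<Rightarrow> 'a set set \<Rightarrow> 'a set set \<Rightarrow> 'a set set \<Rightarrow> bool" where
  "is_finest_common_coarsening A \<alpha> \<beta> \<gamma> \<longleftrightarrow>
     refines A \<alpha> \<gamma> \<and> refines A \<beta> \<gamma> \<and>
     (\<forall>\<delta>. refines A \<alpha> \<delta> \<and> refines A \<beta> \<delta> \<longrightarrow> refines A \<gamma> \<delta>)"

definition partition_join :: "'a set \<Rightarrow> 'a set set \<Rightarrow> 'a set set \<Rightarrow> 'a set set" where
  "partition_join A \<alpha> \<beta> = (THE \<gamma>. is_finest_common_coarsening A \<alpha> \<beta> \<gamma>)"

lemma finest_common_coarsening_unique:
  assumes "is_finest_common_coarsening A \<alpha> \<beta> \<gamma>" "is_finest_common_coarsening A \<alpha> \<beta> \<gamma>'"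
  shows "\<gamma> = \<gamma>'"
  by (rule refines_asym[of A]) (use assms in \<open>simp_all add: is_finest_common_coarsening_def\<close>)

lemma finest_common_coarsening_exists:
  assumes \<alpha>: "partition_on A \<alpha>" and \<beta>: "partition_on A \<beta>"
  shows "\<exists>\<gamma>. is_finest_common_coarsening A \<alpha> \<beta> \<gamma>"
proof -
  define R where "R = {(x, y). \<exists>B\<in>\<alpha> \<union> \<beta>. x \<in> B \<and> y \<in> B}"
  have sub: "B \<subseteq> A" if "B \<in> \<alpha> \<union> \<beta>" for B
    using that \<alpha> \<beta> by (auto simp: partition_on_def)
  have RA: "R \<subseteq> A \<times> A" using sub by (auto simp: R_def)
  have "sym R" by (auto simp: R_def sym_def)
  moreover have "refl_on A R"
    using \<alpha> by (fastforce simp: R_def refl_on_def partition_on_def)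
  ultimately have eq: "equiv A (R\<^sup>+)"
    by (intro equivI trancl_subset_Sigma[OF RA] sym_trancl trans_trancl)
       (auto simp: refl_on_def)
  have part: "partition_on A (A // R\<^sup>+)"
    by (rule partition_on_quotient[OF eq])
  have fine: "\<exists>Y\<in>A // R\<^sup>+. B \<subseteq> Y" if B: "B \<in> \<alpha> \<union> \<beta>" for B
  proof -
    have "B \<noteq> {}" using B \<alpha> \<beta> by (auto simp: partition_on_def)
    then obtain x where x: "x \<in> B" by blast
    have "(x, y) \<in> R" if "y \<in> B" for y using B x that unfolding R_def by blast
    then have "B \<subseteq> R\<^sup>+ `` {x}" by auto
    moreover have "x \<in> A" using x sub B by blast
    ultimately show ?thesis by (meson quotientI)
  qed
  have least: "refines A (A // R\<^sup>+) \<delta>" if d: "refines A \<alpha> \<delta>" "refines A \<beta> \<delta>" for \<delta>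
    unfolding refines_def
  proof (intro conjI part ballI)
    show pd: "partition_on A \<delta>" using d by (simp add: refines_def)
    fix X assume "X \<in> A // R\<^sup>+"
    then obtain x where x: "x \<in> A" "X = R\<^sup>+ `` {x}" by (auto elim: quotientE)
    obtain D where D: "D \<in> \<delta>" "x \<in> D" using x pd by (auto simp: partition_on_def)
    have step: "z \<in> D" if y: "y \<in> D" and yz: "(y, z) \<in> R" for y z
    proof -
      obtain B where B: "B \<in> \<alpha> \<union> \<beta>" "y \<in> B" "z \<in> B" using yz unfolding R_def by blast
      then obtain D' where D': "D' \<in> \<delta>" "B \<subseteq> D'" using d unfolding refines_def by blast
      have "D' = D" using pd D(1) y B(2) D'
        unfolding partition_on_def disjoint_def by blast
      then show ?thesis using B D' by blast
    qed
    have "y \<in> D" if "(x, y) \<in> R\<^sup>+" for y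
      using that by (induction rule: trancl_induct) (use D(2) step in blast)+
    then show "\<exists>Y\<in>\<delta>. X \<subseteq> Y" using x D by blast
  qed
  have "refines A \<alpha> (A // R\<^sup>+)" "refines A \<beta> (A // R\<^sup>+)"
    unfolding refines_def using \<alpha> \<beta> part fine by blast+
  then show ?thesis
    unfolding is_finest_common_coarsening_def using least by blast
qed

lemma partition_join:
  assumes "partition_on A \<alpha>" "partition_on A \<beta>"
  shows "is_finest_common_coarsening A \<alpha> \<beta> (partition_join A \<alpha> \<beta>)"
proof -
  have "\<exists>!\<gamma>. is_finest_common_coarsening A \<alpha> \<beta> \<gamma>"
    by (rule ex_ex1I[OF finest_common_coarsening_exists[OF assms]])
      (rule finest_common_coarsening_unique)
  from theI'[OF this] show ?thesis
    unfolding partition_join_def .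
qed

definition minor_join ::
  "'i set \<Rightarrow> ('i \<Rightarrow> 'a set) \<Rightarrow> ('i \<Rightarrow> 'a set set) \<Rightarrow> ('i \<Rightarrow> 'a set set) \<Rightarrow> ('i \<Rightarrow> 'a set set)" where
  "minor_join I U \<Lambda> \<Lambda>' = (\<lambda>i\<in>I. partition_join (U i) (\<Lambda> i) (\<Lambda>' i))"

definition fibre :: "'i set \<Rightarrow> ('i \<Rightarrow> 'a set set) \<Rightarrow> ('i \<Rightarrow> 'a set) \<Rightarrow> ('i \<Rightarrow> 'a set) set" where
  "fibre I \<Lambda>' t = {s \<in> minor_subproduct I \<Lambda>'. PiE I s \<subseteq> PiE I t}"

text \<open>For \<open>T\<close> a subset of the minor-subproduct of \<open>\<Lambda>'\<close>, \<open>lower_minor I U \<Lambda>' T \<Lambda>\<close> and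
  \<open>upper_minor I U \<Lambda>' T \<Lambda>\<close> are \<open>T\<^sub>M\<close> and \<open>T\<^sup>M\<close>, where \<open>M\<close> is the minor-subproduct of \<open>\<Lambda>\<close>.\<close>

definition lower_minor ::
  "'i set \<Rightarrow> ('i \<Rightarrow> 'a set) \<Rightarrow> ('i \<Rightarrow> 'a set set) \<Rightarrow> ('i \<Rightarrow> 'a set) set \<Rightarrow> ('i \<Rightarrow> 'a set set)
    \<Rightarrow> ('i \<Rightarrow> 'a set) set" where
  "lower_minor I U \<Lambda>' T \<Lambda> =
     {t \<in> minor_subproduct I (minor_join I U \<Lambda> \<Lambda>'). fibre I \<Lambda>' t \<inter> T \<noteq> {}}"

definition upper_minor ::
  "'i set \<Rightarrow> ('i \<Rightarrow> 'a set) \<Rightarrow> ('i \<Rightarrow> 'a set set) \<Rightarrow> ('i \<Rightarrow> 'a set) set \<Rightarrow> ('i \<Rightarrow> 'a set set)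
    \<Rightarrow> ('i \<Rightarrow> 'a set) set" where
  "upper_minor I U \<Lambda>' T \<Lambda> =
     {t \<in> minor_subproduct I (minor_join I U \<Lambda> \<Lambda>'). fibre I \<Lambda>' t \<subseteq> T}"

text \<open>\<open>S\<^sub>M\<close> and \<open>S\<^sup>M\<close> for \<open>S \<subseteq> U\<close>; see \<open>lower_set_eq\<close> and \<open>upper_set_eq\<close> below
  for direct descriptions.\<close>

definition lower_set ::
  "'i set \<Rightarrow> ('i \<Rightarrow> 'a set) \<Rightarrow> ('i \<Rightarrow> 'a) set \<Rightarrow> ('i \<Rightarrow> 'a set set) \<Rightarrow> ('i \<Rightarrow> 'a set) set" where
  "lower_set I U S \<Lambda> = lower_minor I U (singleton_partition I U) (singleton_boxes I S) \<Lambda>"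

definition upper_set ::
  "'i set \<Rightarrow> ('i \<Rightarrow> 'a set) \<Rightarrow> ('i \<Rightarrow> 'a) set \<Rightarrow> ('i \<Rightarrow> 'a set set) \<Rightarrow> ('i \<Rightarrow> 'a set) set" where
  "upper_set I U S \<Lambda> = upper_minor I U (singleton_partition I U) (singleton_boxes I S) \<Lambda>"

lemma minor_join_singleton_partition:
  assumes "\<Lambda> \<in> MProd I U"
  shows "minor_join I U \<Lambda> (singleton_partition I U) = \<Lambda>"
proof -
  have "partition_join (U i) (\<Lambda> i) ((\<lambda>x. {x}) ` U i) = \<Lambda> i" if i: "i \<in> I" for i
  proof -
    have p: "partition_on (U i) (\<Lambda> i)" using assms i by (auto simp: MProd_def)
    have q: "partition_on (U i) ((\<lambda>x. {x}) ` U i)"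
      by (auto simp: partition_on_def disjoint_def)
    have "refines (U i) ((\<lambda>x. {x}) ` U i) (\<Lambda> i)"
      using p q by (auto simp: refines_def partition_on_def)
    then have "is_finest_common_coarsening (U i) (\<Lambda> i) ((\<lambda>x. {x}) ` U i) (\<Lambda> i)"
      using p by (auto simp: is_finest_common_coarsening_def refines_refl)
    then show ?thesis
      using partition_join[OF p q] finest_common_coarsening_unique by metis
  qed
  moreover have "\<Lambda> \<in> extensional I" using assms by (auto simp: MProd_def PiE_def)
  ultimately show ?thesis
    unfolding minor_join_def singleton_partition_def
    by (intro extensionalityI[of _ I]) simp_all
qed

lemma fibre_singleton_partition:
  assumes "\<Lambda> \<in> MProd I U" "t \<in> minor_subproduct I \<Lambda>"
  shows "fibre I (singleton_partition I U) t = singleton_boxes I (PiE I t)"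
proof -
  have tU: "t i \<subseteq> U i" if "i \<in> I" for i
    using assms that by (fastforce simp: MProd_def minor_subproduct_def partition_on_def PiE_iff)
  have ss: "PiE I (\<lambda>i\<in>I. {x i}) \<subseteq> PiE I t \<longleftrightarrow> x \<in> PiE I t" if "x \<in> extensional I" for x
  proof -
    have "PiE I (\<lambda>i\<in>I. {x i}) = {x}"
      using that by (intro equalityI subsetI singletonI)
        (auto simp: PiE_iff intro: extensionalityI[of _ I])
    then show ?thesis by simp
  qed
  show ?thesis
  proof (intro set_eqI iffI)
    fix s assume s: "s \<in> fibre I (singleton_partition I U) t"
    then have m: "s \<in> extensional I" "\<forall>i\<in>I. \<exists>a. s i = {a}"
      by (auto simp: fibre_def minor_subproduct_def singleton_partition_def PiE_iff)
    define x where "x = (\<lambda>i\<in>I. the_elem (s i))"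
    have "s = (\<lambda>i\<in>I. {x i})"
      using m by (fastforce simp: x_def fun_eq_iff extensional_def)
    moreover have "x \<in> extensional I" by (simp add: x_def)
    ultimately show "s \<in> singleton_boxes I (PiE I t)"
      using s ss[of x] by (auto simp: fibre_def singleton_boxes_def)
  next
    fix s assume "s \<in> singleton_boxes I (PiE I t)"
    then obtain x where x: "x \<in> PiE I t" "s = (\<lambda>i\<in>I. {x i})"
      by (auto simp: singleton_boxes_def)
    then show "s \<in> fibre I (singleton_partition I U) t"
      using ss[of x] subsetD[OF tU]
      by (auto simp: fibre_def minor_subproduct_def singleton_partition_def PiE_iff)
  qed
qed

lemma inj_on_singleton_boxes: "inj_on (\<lambda>x. \<lambda>i\<in>I. {x i}) (extensional I)"
proof (rule inj_onI, rule extensionalityI[of _ I])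
  fix x y :: "'a \<Rightarrow> 'b" and i
  assume eq: "(\<lambda>i\<in>I. {x i}) = (\<lambda>i\<in>I. {y i})" and i: "i \<in> I"
  from fun_cong[OF eq, of i] i show "x i = y i" by simp
qed

lemma lower_set_eq:
  fixes U :: "'i \<Rightarrow> 'a set"
  assumes "\<Lambda> \<in> MProd I U" "S \<subseteq> PiE I U"
  shows "lower_set I U S \<Lambda> = {t \<in> minor_subproduct I \<Lambda>. PiE I t \<inter> S \<noteq> {}}"
proof -
  have "singleton_boxes I (PiE I t) \<inter> singleton_boxes I S = singleton_boxes I (PiE I t \<inter> S)"
    for t unfolding singleton_boxes_def
    by (rule inj_on_image_Int[OF inj_on_singleton_boxes, symmetric])
       (use assms(2) in \<open>auto simp: PiE_def\<close>)
  moreover have "singleton_boxes I T = {} \<longleftrightarrow> T = {}" for T :: "('i \<Rightarrow> 'a) set"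
    by (simp add: singleton_boxes_def)
  ultimately have "singleton_boxes I (PiE I t) \<inter> singleton_boxes I S = {} \<longleftrightarrow> PiE I t \<inter> S = {}" for t
    by simp
  then show ?thesis
    unfolding lower_set_def lower_minor_def minor_join_singleton_partition[OF assms(1)]
    by (intro Collect_cong conj_cong refl) (simp add: fibre_singleton_partition[OF assms(1)])
qed

lemma upper_set_eq:
  fixes U :: "'i \<Rightarrow> 'a set"
  assumes "\<Lambda> \<in> MProd I U" "S \<subseteq> PiE I U"
  shows "upper_set I U S \<Lambda> = {t \<in> minor_subproduct I \<Lambda>. PiE I t \<subseteq> S}"
proof -
  have ext: "PiE I t \<subseteq> extensional I" "S \<subseteq> extensional I" for t :: "'i \<Rightarrow> 'a set"
    using assms(2) by (auto simp: PiE_def)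
  have "singleton_boxes I (PiE I t) \<subseteq> singleton_boxes I S \<longleftrightarrow> PiE I t \<subseteq> S" for t
    unfolding singleton_boxes_def
    using inj_on_image_mem_iff[OF inj_on_singleton_boxes _ ext(2)] ext(1)[of t]
    unfolding image_subset_iff by blast
  then show ?thesis
    unfolding upper_set_def upper_minor_def minor_join_singleton_partition[OF assms(1)]
    by (intro Collect_cong conj_cong refl) (simp add: fibre_singleton_partition[OF assms(1)])
qed


definition hamming_dist :: "'i set \<Rightarrow> ('i \<Rightarrow> 'b) \<Rightarrow> ('i \<Rightarrow> 'b) \<Rightarrow> nat" where
  "hamming_dist I x y = card {i \<in> I. x i \<noteq> y i}"

text \<open>A path of the Hamming graph through the vertices \<open>p\<close>; its length is \<open>length p - 1\<close>.\<close>

definition hamming_path :: "'i set \<Rightarrow> ('i \<Rightarrow> 'b) list \<Rightarrow> bool" where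
  "hamming_path I p \<longleftrightarrow> p \<noteq> [] \<and> successively (\<lambda>x y. hamming_dist I x y = 1) p"

definition hamming_connected :: "'i set \<Rightarrow> ('i \<Rightarrow> 'b) set \<Rightarrow> bool" where
  "hamming_connected I T \<longleftrightarrow>
     (\<forall>x\<in>T. \<forall>y\<in>T. \<exists>p. hamming_path I p \<and> set p \<subseteq> T \<and> hd p = x \<and> last p = y)"

definition hamming_isometric :: "'i set \<Rightarrow> ('i \<Rightarrow> 'b) set \<Rightarrow> bool" where
  "hamming_isometric I T \<longleftrightarrow>
     (\<forall>x\<in>T. \<forall>y\<in>T. \<exists>p. hamming_path I p \<and> set p \<subseteq> T \<and> hd p = x \<and> last p = y \<and>
        length p - 1 = hamming_dist I x y)"


definition parallel :: "'i set \<Rightarrow> ('i \<Rightarrow> 'a set) \<Rightarrow> ('i \<Rightarrow> 'a set) \<Rightarrow> bool" where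
  "parallel I B B' \<longleftrightarrow> (\<forall>i\<in>I. B i = B' i \<or> (card (B i) = 1 \<and> card (B' i) = 1))"

text \<open>The box \<open>V \<times> t\<close> for a product \<open>V\<close> over the coordinates \<open>A\<close> and a tuple \<open>t\<close> over \<open>I - A\<close>.\<close>

definition box_times :: "'i set \<Rightarrow> 'i set \<Rightarrow> ('i \<Rightarrow> 'a set) \<Rightarrow> ('i \<Rightarrow> 'a) \<Rightarrow> ('i \<Rightarrow> 'a set)" where
  "box_times I A V t = (\<lambda>i\<in>I. if i \<in> A then V i else {t i})"

text \<open>The gallery consists of the boxes \<open>V \<times> t\<close> for \<open>t\<close> in the list \<open>ts\<close>.\<close>

definition geodesic_gallery ::
  "'i set \<Rightarrow> ('i \<Rightarrow> 'a set) \<Rightarrow> 'i set \<Rightarrow> ('i \<Rightarrow> 'a set) \<Rightarrow> ('i \<Rightarrow> 'a) list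
    \<Rightarrow> ('i \<Rightarrow> 'a set) \<Rightarrow> ('i \<Rightarrow> 'a set) \<Rightarrow> bool" where
  "geodesic_gallery I U A V ts B B' \<longleftrightarrow>
     A \<subseteq> I \<and> V \<in> boxes A U \<and> set ts \<subseteq> PiE (I - A) U \<and>
     hamming_path (I - A) ts \<and>
     B = box_times I A V (hd ts) \<and> B' = box_times I A V (last ts) \<and>
     length ts - 1 = hamming_dist (I - A) (hd ts) (last ts)"

definition box_superisometric :: "'i set \<Rightarrow> ('i \<Rightarrow> 'a set) \<Rightarrow> ('i \<Rightarrow> 'a) set \<Rightarrow> bool" where
  "box_superisometric I U S \<longleftrightarrow>
     (\<forall>B\<in>boxes I U. \<forall>B'\<in>boxes I U.
        parallel I B B' \<and> PiE I B \<subseteq> S \<and> PiE I B' \<subseteq> S \<longrightarrow>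
        (\<exists>A V ts. geodesic_gallery I U A V ts B B' \<and>
           (\<forall>t\<in>set ts. PiE I (box_times I A V t) \<subseteq> S)))"

end

theory Submission
  imports Defs
begin

text \<open>
  Every condition is shown equivalent to the self-dual condition \<open>minimax\<close>: for each box, split into
  factors over \<open>A\<close> and over \<open>I - A\<close>, if every \<open>x\<close> in the first factor has a \<open>y\<close> in the second with
  \<open>(x, y) \<in> S\<close>, then some \<open>y\<close> works for all \<open>x\<close>.

  Ampleness is inherited by partial partitions, which may leave points of \<open>U\<close> uncovered. A point \<open>u\<close>
  is removed from a coordinate by comparing the partition in which \<open>{u}\<close> is a block with those in
  which \<open>u\<close> is added to another block \<open>P\<close>: if only copies through \<open>u\<close> arise in the latter and the
  former is not shattered, then a copy and a box avoiding \<open>S\<close> meet in the slice of \<open>u\<close>. The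
  instance with singletons over \<open>A\<close> and a single block over \<open>I - A\<close> is \<open>minimax\<close>. Conversely
  \<open>minimax\<close> yields copies even for arbitrary families of nonempty sets, choosing representatives one
  coordinate at a time. Applied to the complement of \<open>S\<close>, this produces a box of \<open>S\<close> strictly between
  two given ones, hence isometry. Superconnectedness is also inherited by partial partitions, and both
  it and box-superisometry give \<open>minimax\<close> by splitting a side \<open>V j\<close> as \<open>{v} \<union> P\<close>: an edge in
  direction \<open>j\<close> on a path from the \<open>P\<close>-part to the \<open>v\<close>-part yields a common \<open>y\<close>.
\<close>

section \<open>The minimax property\<close>

(* Without this the classical reasoner loops on bounded quantifiers over products. *)
declare PiE [rule del] PiE_E [rule del] PiE_I [rule del]

text \<open>\<open>override_on y x A\<close> agrees with \<open>x\<close> on \<open>A\<close> and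
  with \<open>y\<close> elsewhere, so both players range over full tuples of the box and no products
  over \<open>A\<close> and \<open>I - A\<close> have to be formed. The condition is the nontrivial
  direction of an exchange of quantifiers.\<close>

definition minimax :: "'i set \<Rightarrow> ('i \<Rightarrow> 'a set) \<Rightarrow> ('i \<Rightarrow> 'a) set \<Rightarrow> bool" where
  "minimax I U S \<longleftrightarrow>
     (\<forall>A V. A \<subseteq> I \<and> (\<forall>i\<in>I. V i \<subseteq> U i \<and> V i \<noteq> {}) \<and>
        (\<forall>x\<in>PiE I V. \<exists>y\<in>PiE I V. override_on y x A \<in> S) \<longrightarrow>
        (\<exists>y\<in>PiE I V. \<forall>x\<in>PiE I V. override_on y x A \<in> S))"

lemma minimaxD:
  assumes "minimax I U S" "A \<subseteq> I" "\<And>i. i \<in> I \<Longrightarrow> V i \<subseteq> U i" "\<And>i. i \<in> I \<Longrightarrow> V i \<noteq> {}"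
    and "\<And>x. x \<in> PiE I V \<Longrightarrow> \<exists>y\<in>PiE I V. override_on y x A \<in> S"
  obtains y where "y \<in> PiE I V" "\<And>x. x \<in> PiE I V \<Longrightarrow> override_on y x A \<in> S"
proof -
  have "\<exists>y\<in>PiE I V. \<forall>x\<in>PiE I V. override_on y x A \<in> S"
    using assms(1)[unfolded minimax_def, rule_format, of A V] assms(2-5) by simp
  then show ?thesis using that by (elim bexE) simp
qed

lemma override_on_PiE:
  assumes "x \<in> PiE I V" "y \<in> PiE I V"
  shows "override_on y x A \<in> PiE I V"
  using assms by (auto simp: override_on_def PiE_iff extensional_def)

lemma override_on_Diff:
  assumes "x \<in> extensional I" "y \<in> extensional I"
  shows "override_on y x (I - A) = override_on x y A"
  using assms by (auto simp: override_on_def extensional_def fun_eq_iff)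

text \<open>Failure of the conclusion for the complement says that every \<open>y\<close> has an
  \<open>x\<close> with the combined point in \<open>S\<close>. This is the hypothesis of
  \<open>minimax\<close> for \<open>S\<close> with the roles of \<open>A\<close> and
  \<open>I - A\<close> exchanged; its conclusion contradicts the hypothesis for the
  complement.\<close>

lemma minimax_complement:
  assumes "minimax I U S"
  shows "minimax I U (PiE I U - S)"
  unfolding minimax_def
proof (intro allI impI, elim conjE)
  fix A V
  assume A: "A \<subseteq> I" and V: "\<forall>i\<in>I. V i \<subseteq> U i \<and> V i \<noteq> {}"
    and H: "\<forall>x\<in>PiE I V. \<exists>y\<in>PiE I V. override_on y x A \<in> PiE I U - S"
  have sub: "PiE I V \<subseteq> PiE I U" using V by (intro PiE_mono) auto
  have swap: "override_on y x (I - A) = override_on x y A" if "x \<in> PiE I V" "y \<in> PiE I V" for x y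
    using that by (intro override_on_Diff) (auto simp: PiE_def)
  show "\<exists>y\<in>PiE I V. \<forall>x\<in>PiE I V. override_on y x A \<in> PiE I U - S"
  proof (rule ccontr)
    assume neg: "\<not> ?thesis"
    have "\<exists>x\<in>PiE I V. override_on y x A \<in> S" if y: "y \<in> PiE I V" for y
    proof -
      obtain x where x: "x \<in> PiE I V" "override_on y x A \<notin> PiE I U - S"
        using neg y by blast
      then show ?thesis using override_on_PiE[OF x(1) y] sub by blast
    qed
    then have "\<forall>y\<in>PiE I V. \<exists>x\<in>PiE I V. override_on x y (I - A) \<in> S"
      by (simp add: swap cong: bex_cong)
    then have "\<exists>x\<in>PiE I V. \<forall>y\<in>PiE I V. override_on x y (I - A) \<in> S"
      using assms V unfolding minimax_def by blast
    then have "\<exists>x\<in>PiE I V. \<forall>y\<in>PiE I V. override_on y x A \<in> S"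
      by (simp add: swap cong: bex_cong)
    then show False using H by blast
  qed
qed

section \<open>Shattering by families of nonempty sets\<close>

definition set_families :: "'i set \<Rightarrow> ('i \<Rightarrow> 'a set) \<Rightarrow> ('i \<Rightarrow> 'a set set) \<Rightarrow> bool" where
  "set_families I U F \<longleftrightarrow> (\<forall>i\<in>I. F i \<subseteq> Pow (U i) - {{}})"

definition partial_partitions :: "'i set \<Rightarrow> ('i \<Rightarrow> 'a set) \<Rightarrow> ('i \<Rightarrow> 'a set set) \<Rightarrow> bool" where
  "partial_partitions I U F \<longleftrightarrow> set_families I U F \<and> (\<forall>i\<in>I. disjoint (F i))"

text \<open>Functional form of a copy: representatives are chosen by functions, so that one
  coordinate or one block can be altered at a time.\<close>

definition selection ::
  "'i set \<Rightarrow> ('i \<Rightarrow> 'a) set \<Rightarrow> ('i \<Rightarrow> 'a set set) \<Rightarrow> ('i \<Rightarrow> 'a set \<Rightarrow> 'a) \<Rightarrow> bool" where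
  "selection I S F f \<longleftrightarrow>
     (\<forall>i\<in>I. \<forall>B\<in>F i. f i B \<in> B) \<and> (\<forall>t\<in>PiE I F. (\<lambda>i\<in>I. f i (t i)) \<in> S)"

lemma selectionI:
  assumes "\<And>i B. i \<in> I \<Longrightarrow> B \<in> F i \<Longrightarrow> f i B \<in> B"
    and "\<And>t. t \<in> PiE I F \<Longrightarrow> (\<lambda>i\<in>I. f i (t i)) \<in> S"
  shows "selection I S F f"
  using assms by (simp add: selection_def)

lemma selection_mem: "selection I S F f \<Longrightarrow> i \<in> I \<Longrightarrow> B \<in> F i \<Longrightarrow> f i B \<in> B"
  by (simp add: selection_def)

lemma selection_in: "selection I S F f \<Longrightarrow> t \<in> PiE I F \<Longrightarrow> (\<lambda>i\<in>I. f i (t i)) \<in> S"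
  by (simp add: selection_def)

lemma selection_mono:
  assumes "selection I S F f" "\<And>i. i \<in> I \<Longrightarrow> G i \<subseteq> F i"
  shows "selection I S G f"
proof (rule selectionI)
  have "PiE I G \<subseteq> PiE I F" using assms(2) by (rule PiE_mono)
  then show "(\<lambda>i\<in>I. f i (t i)) \<in> S" if "t \<in> PiE I G" for t
    by (rule selection_in[OF assms(1) subsetD]) (rule that)
  show "f i B \<in> B" if "i \<in> I" "B \<in> G i" for i B
    by (rule selection_mem[OF assms(1)]) (use assms(2) that in auto)
qed

lemma shattered_PiE: "shattered I S F \<longleftrightarrow> (\<forall>t\<in>PiE I F. S \<inter> PiE I t \<noteq> {})"
  by (simp add: shattered_def minor_subproduct_def)

lemma shatteredD: "shattered I S F \<Longrightarrow> t \<in> PiE I F \<Longrightarrow> S \<inter> PiE I t \<noteq> {}"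
  by (simp add: shattered_PiE)

lemma shattered_mono:
  assumes "shattered I S F" "\<And>i. i \<in> I \<Longrightarrow> G i \<subseteq> F i"
  shows "shattered I S G"
proof -
  have "PiE I G \<subseteq> PiE I F" using assms(2) by (rule PiE_mono)
  then show ?thesis using assms(1) unfolding shattered_PiE by (meson subsetD)
qed

text \<open>A copy yields \<open>f\<close> by choosing a common point of \<open>W i\<close> and each
  block. Conversely the image of \<open>M i\<close> under \<open>f i\<close> meets each block only
  once because the blocks are disjoint.\<close>

lemma strongly_shattered_iff_selection:
  assumes "M \<in> MProd I U"
  shows "strongly_shattered I U S M \<longleftrightarrow> (\<exists>f. selection I S M f)"
proof
  assume "strongly_shattered I U S M"
  then obtain C where C: "is_copy I U M C" "C \<subseteq> S"
    unfolding strongly_shattered_def by blast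
  from C(1) obtain W where CW: "C = PiE I W"
    "\<forall>i\<in>I. W i \<subseteq> U i \<and> (\<forall>B\<in>M i. \<exists>!x. x \<in> W i \<and> x \<in> B)"
    unfolding is_copy_def by (elim exE conjE) (rule that)
  have W: "\<exists>x. x \<in> W i \<and> x \<in> B" if "i \<in> I" "B \<in> M i" for i B
    using CW(2) that by (metis (no_types, lifting))
  define f where "f = (\<lambda>i B. SOME x. x \<in> W i \<and> x \<in> B)"
  have f: "f i B \<in> W i \<and> f i B \<in> B" if "i \<in> I" "B \<in> M i" for i B
    unfolding f_def by (rule someI_ex) (rule W[OF that])
  have "(\<lambda>i\<in>I. f i (t i)) \<in> PiE I W" if "t \<in> PiE I M" for t
    using that f by (auto simp: PiE_iff)
  then have "selection I S M f"
    unfolding selection_def using f C(2) CW(1) by (intro conjI ballI) (simp, blast)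
  then show "\<exists>f. selection I S M f" by (intro exI)
next
  assume "\<exists>f. selection I S M f"
  then obtain f where f: "\<forall>i\<in>I. \<forall>B\<in>M i. f i B \<in> B" "\<forall>t\<in>PiE I M. (\<lambda>i\<in>I. f i (t i)) \<in> S"
    unfolding selection_def by (elim exE conjE)
  define W where "W = (\<lambda>i. f i ` M i)"
  have part: "partition_on (U i) (M i)" if "i \<in> I" for i
    using assms that by (auto simp: MProd_def PiE_iff)
  have "W i \<subseteq> U i" if "i \<in> I" for i
    using f(1) that part[OF that] unfolding W_def partition_on_def by blast
  moreover have "\<exists>!x. x \<in> W i \<and> x \<in> B" if i: "i \<in> I" and B: "B \<in> M i" for i B
  proof (rule ex1I[of _ "f i B"])
    show "f i B \<in> W i \<and> f i B \<in> B" using f(1) i B by (auto simp: W_def)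
    fix x assume x: "x \<in> W i \<and> x \<in> B"
    then obtain B' where B': "B' \<in> M i" "x = f i B'" by (auto simp: W_def)
    then have "x \<in> B'" using f(1) i by blast
    then have "B = B'"
      using part[OF i] B B' x unfolding partition_on_def disjoint_def by blast
    then show "x = f i B" using B' by simp
  qed
  ultimately have "is_copy I U M (PiE I W)"
    unfolding is_copy_def by (intro exI[of _ W] conjI ballI refl) simp_all
  moreover have "PiE I W \<subseteq> S"
  proof
    fix x assume x: "x \<in> PiE I W"
    then have "\<forall>i\<in>I. \<exists>B. B \<in> M i \<and> x i = f i B" by (auto simp: W_def PiE_iff)
    then obtain t where t: "\<forall>i\<in>I. t i \<in> M i \<and> x i = f i (t i)" by metis
    have "x = (\<lambda>i\<in>I. f i (restrict t I i))"
      using x t by (auto simp: fun_eq_iff PiE_iff extensional_def)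
    then show "x \<in> S" using f(2) t by (metis restrict_PiE_iff)
  qed
  ultimately show "strongly_shattered I U S M" unfolding strongly_shattered_def by blast
qed

lemma MProd_partial_partitions:
  "M \<in> MProd I U \<Longrightarrow> partial_partitions I U M"
  unfolding MProd_def partial_partitions_def set_families_def
  by (auto simp: partition_on_def PiE_iff)

lemma partial_partitions_total:
  assumes "partial_partitions I U F" "\<And>i. i \<in> I \<Longrightarrow> U i \<subseteq> \<Union> (F i)"
  shows "restrict F I \<in> MProd I U"
  using assms unfolding partial_partitions_def set_families_def MProd_def partition_on_def
  by (fastforce simp: PiE_iff)

section \<open>Partial partitions and induction on uncovered points\<close>

definition deficit :: "'i set \<Rightarrow> ('i \<Rightarrow> 'a set) \<Rightarrow> ('i \<Rightarrow> 'a set set) \<Rightarrow> nat" where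
  "deficit I U F = (\<Sum>i\<in>I. card (U i - \<Union> (F i)))"

lemma deficit_less:
  assumes "finite I" "\<forall>i\<in>I. finite (U i)" "j \<in> I" "u \<in> U j" "u \<notin> \<Union> (F j)"
    "\<Union> (F j) \<subseteq> \<Union> G" "u \<in> \<Union> G"
  shows "deficit I U (F(j := G)) < deficit I U F"
  unfolding deficit_def
proof (rule sum_strict_mono_ex1[OF assms(1)])
  have "card (U j - \<Union> G) < card (U j - \<Union> (F j))"
    by (rule psubset_card_mono) (use assms in auto)
  then show "\<exists>a\<in>I. card (U a - \<Union> ((F(j := G)) a)) < card (U a - \<Union> (F a))"
    using assms(3) by auto
  then show "\<forall>i\<in>I. card (U i - \<Union> ((F(j := G)) i)) \<le> card (U i - \<Union> (F i))"
    using assms by (auto intro!: card_mono)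
qed

lemma partial_partitions_add:
  assumes "partial_partitions I U F" "j \<in> I" "u \<in> U j" "u \<notin> \<Union> (F j)"
  shows "partial_partitions I U (F(j := insert {u} (F j)))"
  using assms unfolding partial_partitions_def set_families_def
  by (auto simp: disjoint_def)

lemma partial_partitions_enlarge:
  assumes "partial_partitions I U F" "j \<in> I" "u \<in> U j" "u \<notin> \<Union> (F j)" "P \<in> F j"
  shows "partial_partitions I U (F(j := insert (insert u P) (F j - {P})))"
proof -
  have "disjoint (F j)" using assms by (auto simp: partial_partitions_def)
  then have "disjoint (insert (insert u P) (F j - {P}))"
    using assms(4,5) unfolding disjoint_def by blast
  then show ?thesis
    using assms unfolding partial_partitions_def set_families_def by auto
qed

text \<open>Induction on \<open>deficit\<close>: covering \<open>u\<close>, either by a block of its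
  own or by adding it to a block \<open>P\<close>, lowers the number of uncovered points, and a
  partial partition without uncovered points is a generalized partition.\<close>

lemma partial_partitions_induct [consumes 3, case_names total step]:
  assumes "finite I" "\<forall>i\<in>I. finite (U i)" "partial_partitions I U F"
    and total: "\<And>F. restrict F I \<in> MProd I U \<Longrightarrow> Q F"
    and step: "\<And>F j u. \<lbrakk>partial_partitions I U F; j \<in> I; u \<in> U j; u \<notin> \<Union> (F j);
        Q (F(j := insert {u} (F j)));
        \<And>P. P \<in> F j \<Longrightarrow> Q (F(j := insert (insert u P) (F j - {P})))\<rbrakk> \<Longrightarrow> Q F"
  shows "Q F"
  using assms(3)
proof (induction "deficit I U F" arbitrary: F rule: less_induct)
  case less
  show ?case
  proof (cases "\<forall>i\<in>I. U i \<subseteq> \<Union> (F i)")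
    case True
    then show ?thesis using total partial_partitions_total[OF less.prems] by blast
  next
    case False
    then obtain j u where ju: "j \<in> I" "u \<in> U j" "u \<notin> \<Union> (F j)" by blast
    show ?thesis
    proof (rule step[OF less.prems ju])
      show "Q (F(j := insert {u} (F j)))"
        by (rule less.hyps[OF deficit_less partial_partitions_add])
           (use assms(1,2) ju less.prems in auto)
      fix P assume "P \<in> F j"
      then show "Q (F(j := insert (insert u P) (F j - {P})))"
        by (intro less.hyps[OF deficit_less partial_partitions_enlarge])
           (use assms(1,2) ju less.prems in auto)
    qed
  qed
qed

lemma selection_restrict: "selection I S (restrict F I) f \<longleftrightarrow> selection I S F f"
  by (simp add: selection_def cong: PiE_cong)

lemma shattered_restrict: "shattered I S (restrict F I) \<longleftrightarrow> shattered I S F"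
  by (simp add: shattered_PiE cong: PiE_cong)

text \<open>The total case is ampleness itself. For an uncovered \<open>u\<close>, a selection for
  \<open>?G\<close> (with block \<open>{u}\<close>) restricts to \<open>F\<close>, while one for
  \<open>?H\<close> (with \<open>u\<close> added to \<open>P\<close>) transfers to \<open>F\<close>
  as soon as the representative of \<open>insert u P\<close> lies in \<open>P\<close>; this is
  guaranteed when \<open>?G\<close> is not shattered.\<close>

lemma ample_selection:
  assumes "finite I" "\<forall>i\<in>I. finite (U i)" "ample I U S"
    and "partial_partitions I U F" "shattered I S F"
  shows "\<exists>f. selection I S F f"
  using assms(1,2,4,5)
proof (induction rule: partial_partitions_induct)
  case (total F)
  then show ?case
    using assms(3) strongly_shattered_iff_selection[OF total(1)]
    unfolding ample_def by (metis selection_restrict shattered_restrict)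
next
  case (step F j u)
  show ?case
  proof (cases "F j = {}")
    \<comment> \<open>With \<open>F j\<close> empty there is no block to which \<open>u\<close>
      could be added, but there are no tuples of blocks either, so any representatives form a
      selection.\<close>
    case True
    then have "PiE I F = {}" using step by (auto simp: PiE_eq_empty_iff)
    moreover have "\<forall>i\<in>I. \<forall>B\<in>F i. (SOME b. b \<in> B) \<in> B"
      using step by (auto simp: partial_partitions_def set_families_def some_in_eq)
    ultimately have "selection I S F (\<lambda>i B. SOME b. b \<in> B)" by (auto simp: selection_def)
    then show ?thesis by (intro exI)
  next
    case False
    then obtain P where P: "P \<in> F j" by blast
    let ?G = "F(j := insert {u} (F j))" and ?H = "F(j := insert (insert u P) (F j - {P}))"
    show ?thesis
    proof (cases "shattered I S ?G")
      case True
      then obtain f where f: "selection I S ?G f" using step by blast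
      have "selection I S F f" by (rule selection_mono[OF f]) auto
      then show ?thesis by (intro exI)
    next
      case False
      then obtain t where t: "t \<in> PiE I ?G" "S \<inter> PiE I t = {}" by (auto simp: shattered_PiE)
      \<comment> \<open>All boxes of \<open>F\<close> meet \<open>S\<close>, so the missed box lies
        in the slice of \<open>u\<close>.\<close>
      have tj: "t j = {u}"
      proof (rule ccontr)
        assume "t j \<noteq> {u}"
        then have "t \<in> PiE I F"
          using t(1) step by (auto simp: PiE_iff split: if_splits)
        then show False using t(2) shatteredD[OF step(7)] by simp
      qed
      \<comment> \<open>Each box of \<open>?H\<close> contains a box of \<open>F\<close>.\<close>
      have "shattered I S ?H"
        unfolding shattered_PiE
      proof
        fix s assume s: "s \<in> PiE I ?H"
        define s' where "s' = s(j := if s j = insert u P then P else s j)"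
        have "s' \<in> PiE I F"
          using s P \<open>j \<in> I\<close> by (auto simp: s'_def PiE_iff extensional_def split: if_splits)
        moreover have "PiE I s' \<subseteq> PiE I s" by (rule PiE_mono) (auto simp: s'_def)
        ultimately show "S \<inter> PiE I s \<noteq> {}" using shatteredD[OF step(7), of s'] by auto
      qed
      then obtain f where f: "selection I S ?H f" using step(6)[OF P] by blast
      have fu: "f j (insert u P) \<in> insert u P"
        using f \<open>j \<in> I\<close> unfolding selection_def by auto
      \<comment> \<open>If \<open>u\<close> were chosen, the representatives of the blocks of
        \<open>t\<close>, with \<open>insert u P\<close> at \<open>j\<close>, would form a point of
        \<open>S\<close> in the box of \<open>t\<close>, which avoids \<open>S\<close>.\<close>
      have "f j (insert u P) \<noteq> u"
      proof
        assume eq: "f j (insert u P) = u"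
        let ?s = "t(j := insert u P)" and ?z = "\<lambda>i\<in>I. f i ((t(j := insert u P)) i)"
        have "?s \<in> PiE I ?H"
          using t(1) \<open>j \<in> I\<close> by (auto simp: PiE_iff extensional_def split: if_splits)
        then have "?z \<in> S" by (rule selection_in[OF f])
        moreover have "f i (t i) \<in> t i" if "i \<in> I" "i \<noteq> j" for i
          using f t(1) that unfolding selection_def PiE_iff by auto
        then have "?z \<in> PiE I t" using eq tj by (auto simp: PiE_iff)
        ultimately show False using t(2) by blast
      qed
      then have fP: "f j (insert u P) \<in> P" using fu by blast
      define g where "g = f(j := (f j)(P := f j (insert u P)))"
      have "(\<lambda>i\<in>I. g i (s i)) \<in> S" if s: "s \<in> PiE I F" for s
      proof -
        define s' where "s' = s(j := if s j = P then insert u P else s j)"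
        have "s' \<in> PiE I ?H"
          using s \<open>j \<in> I\<close> by (auto simp: s'_def PiE_iff extensional_def)
        then have "(\<lambda>i\<in>I. f i (s' i)) \<in> S" by (rule selection_in[OF f])
        moreover have "(\<lambda>i\<in>I. f i (s' i)) = (\<lambda>i\<in>I. g i (s i))"
          by (auto simp: s'_def g_def fun_eq_iff)
        ultimately show ?thesis by simp
      qed
      moreover have "g i B \<in> B" if "i \<in> I" "B \<in> F i" for i B
        using that f fP unfolding selection_def g_def by (auto split: if_splits)
      ultimately have "selection I S F g" by (simp add: selection_def)
      then show ?thesis by (intro exI)
    qed
  qed
qed

lemma ample_minimax:
  assumes "finite I" "\<forall>i\<in>I. finite (U i)" "ample I U S"
  shows "minimax I U S"
  unfolding minimax_def
proof (intro allI impI, elim conjE)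
  fix A V
  assume A: "A \<subseteq> I" and V: "\<forall>i\<in>I. V i \<subseteq> U i \<and> V i \<noteq> {}"
    and H: "\<forall>x\<in>PiE I V. \<exists>y\<in>PiE I V. override_on y x A \<in> S"
  \<comment> \<open>Prescribing a tuple of blocks amounts to prescribing \<open>x\<close> over
    \<open>A\<close>, so \<open>H\<close> says that \<open>F\<close> is shattered. Over
    \<open>I - A\<close> the single block \<open>V i\<close> has one representative, which cannot
    depend on \<open>x\<close>.\<close>
  define F where "F = (\<lambda>i. if i \<in> A then (\<lambda>v. {v}) ` V i else {V i})"
  have "partial_partitions I U F"
    using V by (auto simp: partial_partitions_def set_families_def F_def disjoint_def)
  moreover have "shattered I S F"
    unfolding shattered_PiE
  proof
    fix t assume t: "t \<in> PiE I F"
    define x where "x = (\<lambda>i\<in>I. SOME b. b \<in> t i)"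
    have tV: "t i \<subseteq> V i" "t i \<noteq> {}" if "i \<in> I" for i
      using t V that by (fastforce simp: PiE_iff F_def split: if_splits)+
    then have xt: "x \<in> PiE I t" by (auto simp: x_def PiE_iff some_in_eq)
    then have "x \<in> PiE I V" using tV(1) by (auto simp: PiE_iff)
    then obtain y where y: "y \<in> PiE I V" "override_on y x A \<in> S" using H by blast
    have "override_on y x A \<in> PiE I t"
      using y(1) xt t by (auto simp: override_on_def PiE_iff F_def extensional_def)
    then show "S \<inter> PiE I t \<noteq> {}" using y(2) by blast
  qed
  ultimately obtain f where f: "selection I S F f"
    using ample_selection[OF assms] by blast
  \<comment> \<open>Over \<open>A\<close> the value is an arbitrary element of \<open>V i\<close>,
    as \<open>override_on\<close> replaces it.\<close>
  define y where "y = (\<lambda>i\<in>I. if i \<in> A then SOME b. b \<in> V i else f i (V i))"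
  have yV: "y \<in> PiE I V"
    using V f by (auto simp: y_def F_def selection_def PiE_iff some_in_eq)
  have "override_on y x A \<in> S" if x: "x \<in> PiE I V" for x
  proof -
    define t where "t = (\<lambda>i\<in>I. if i \<in> A then {x i} else V i)"
    have "t \<in> PiE I F" using x by (auto simp: t_def F_def PiE_iff)
    then have "(\<lambda>i\<in>I. f i (t i)) \<in> S" by (rule selection_in[OF f])
    moreover have "f i {x i} = x i" if "i \<in> A" for i
    proof -
      have "{x i} \<in> F i" using that x A by (auto simp: F_def PiE_iff)
      then show ?thesis using selection_mem[OF f] that A by blast
    qed
    then have "(\<lambda>i\<in>I. f i (t i)) = override_on y x A"
      using A x by (auto simp: fun_eq_iff t_def y_def override_on_def PiE_iff)
    ultimately show ?thesis by simp
  qed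
  then show "\<exists>y\<in>PiE I V. \<forall>x\<in>PiE I V. override_on y x A \<in> S" using yV by blast
qed

section \<open>From \<open>minimax\<close> to selections for arbitrary families\<close>

definition elementary :: "'a set set \<Rightarrow> bool" where
  "elementary G \<longleftrightarrow> (\<forall>B\<in>G. is_singleton B) \<or> (\<exists>B. G = {B})"

text \<open>Coordinates with only singletons form \<open>A\<close>; every other family is the single
  set \<open>V i\<close>. Shattering then supplies the hypothesis of \<open>minimax\<close>, and the
  resulting \<open>y\<close> provides the representatives off \<open>A\<close>.\<close>

lemma minimax_selection_base:
  assumes "minimax I U S" "set_families I U F" "shattered I S F"
    and elementary: "\<forall>i\<in>I. elementary (F i)"
  shows "\<exists>f. selection I S F f"
proof (cases "\<exists>i\<in>I. F i = {}")
  case True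
  then have "PiE I F = {}" by (auto simp: PiE_eq_empty_iff)
  moreover have "\<forall>i\<in>I. \<forall>B\<in>F i. (SOME b. b \<in> B) \<in> B"
    using assms(2) by (auto simp: set_families_def some_in_eq)
  ultimately have "selection I S F (\<lambda>i B. SOME b. b \<in> B)" by (auto simp: selection_def)
  then show ?thesis by (intro exI)
next
  case False
  define A where "A = {i\<in>I. \<forall>B\<in>F i. is_singleton B}"
  define V where "V = (\<lambda>i. \<Union> (F i))"
  have V: "\<forall>i\<in>I. V i \<subseteq> U i \<and> V i \<noteq> {}"
    using assms(2) False unfolding set_families_def V_def by blast
  have FV: "F i = {V i}" if "i \<in> I" "i \<notin> A" for i
    using elementary that by (auto simp: A_def V_def elementary_def)
  have FA: "{v} \<in> F i" if "i \<in> A" "v \<in> V i" for i v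
    using that by (auto simp: A_def V_def is_singleton_def)
  have ex: "\<exists>y\<in>PiE I V. override_on y x A \<in> S" if x: "x \<in> PiE I V" for x
  proof -
    define t where "t = (\<lambda>i\<in>I. if i \<in> A then {x i} else V i)"
    have "t \<in> PiE I F" using x FV FA by (auto simp: t_def PiE_iff)
    then obtain z where z: "z \<in> S" "z \<in> PiE I t" using shatteredD[OF assms(3)] by fast
    have "z \<in> PiE I V" using z(2) x by (auto simp: PiE_iff t_def split: if_splits)
    moreover have "override_on z x A = z"
      using z(2) x by (auto simp: fun_eq_iff override_on_def PiE_iff t_def A_def)
    ultimately show ?thesis using z(1) by (intro bexI[of _ z]) simp_all
  qed
  have "A \<subseteq> I" by (auto simp: A_def)
  then obtain y where y: "y \<in> PiE I V" "\<And>x. x \<in> PiE I V \<Longrightarrow> override_on y x A \<in> S"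
    by (rule minimaxD[OF assms(1), where V = V]) (use V ex in auto)
  define f where "f = (\<lambda>i B. if i \<in> A then the_elem B else y i)"
  have f: "f i B \<in> B" if "i \<in> I" "B \<in> F i" for i B
  proof (cases "i \<in> A")
    case True
    then have "is_singleton B" using that by (simp add: A_def)
    then show ?thesis using True by (auto simp: f_def is_singleton_def)
  next
    case False
    then show ?thesis using FV[of i] that PiE_mem[OF y(1)] by (simp add: f_def)
  qed
  have f_in: "(\<lambda>i\<in>I. f i (t i)) \<in> S" if t: "t \<in> PiE I F" for t
  proof -
    have "(\<lambda>i\<in>I. f i (t i)) \<in> PiE I V"
      using t f by (fastforce simp: V_def PiE_iff)
    then have "override_on y (\<lambda>i\<in>I. f i (t i)) A \<in> S" by (rule y(2))
    moreover have "override_on y (\<lambda>i\<in>I. f i (t i)) A = (\<lambda>i\<in>I. f i (t i))"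
      using y(1) by (auto simp: fun_eq_iff override_on_def f_def PiE_iff extensional_def A_def)
    ultimately show ?thesis by simp
  qed
  have "selection I S F f" by (rule selectionI[OF f f_in])
  then show ?thesis by (intro exI)
qed

text \<open>Induction on the number of coordinates whose family is not elementary. Such a family
  \<open>F j\<close> is first replaced by \<open>{B}\<close> for each \<open>B\<close> in turn,
  which yields a representative \<open>b B\<close>, and then by the singletons \<open>{b B}\<close>;
  a selection for the latter, combined with \<open>b\<close> at \<open>j\<close>, is one for
  \<open>F\<close>.\<close>

lemma minimax_selection:
  assumes "finite I" "minimax I U S" "set_families I U F" "shattered I S F"
  shows "\<exists>f. selection I S F f"
  using assms(3,4)
proof (induction "card {i\<in>I. \<not> elementary (F i)}"
    arbitrary: F rule: less_induct)
  case less
  let ?D = "\<lambda>F. {i\<in>I. \<not> elementary (F i)}"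
  show ?case
  proof (cases "?D F = {}")
    case True
    then show ?thesis using minimax_selection_base[OF assms(2) less.prems] by blast
  next
    case False
    then obtain j where j: "j \<in> ?D F" by blast
    have smaller: "card (?D (F(j := G))) < card (?D F)"
      if "elementary G" for G
    proof (rule psubset_card_mono)
      have "?D (F(j := G)) \<subseteq> ?D F - {j}" using that by auto
      then show "?D (F(j := G)) \<subset> ?D F" using j by blast
    qed (simp add: assms(1))
    have "\<exists>f. selection I S (F(j := {B})) f" if B: "B \<in> F j" for B
    proof (rule less.hyps[OF smaller])
      show "set_families I U (F(j := {B}))"
        using less.prems(1) B j by (auto simp: set_families_def)
      show "shattered I S (F(j := {B}))"
        by (rule shattered_mono[OF less.prems(2)]) (use B in auto)
    qed (simp add: elementary_def)
    then obtain f where f: "\<And>B. B \<in> F j \<Longrightarrow> selection I S (F(j := {B})) (f B)" by metis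
    define b where "b = (\<lambda>B. f B j B)"
    have b: "b B \<in> B" if "B \<in> F j" for B
      using f[OF that] j unfolding selection_def b_def by auto
    let ?G = "F(j := (\<lambda>B. {b B}) ` F j)"
    have "\<exists>g. selection I S ?G g"
    proof (rule less.hyps[OF smaller])
      show "set_families I U ?G"
        using less.prems(1) b j unfolding set_families_def by auto
      \<comment> \<open>The witnesses are the selections \<open>f B\<close> themselves:
        \<open>f B\<close> has the value \<open>b B\<close> at \<open>j\<close>, whichever sets are
        given at the other coordinates.\<close>
      show "shattered I S ?G"
        unfolding shattered_PiE
      proof
          fix t assume t: "t \<in> PiE I ?G"
        have "t j \<in> (\<lambda>B. {b B}) ` F j" using PiE_mem[OF t, of j] j by simp
        then obtain B where B: "B \<in> F j" "t j = {b B}" by auto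
        let ?s = "t(j := B)" and ?z = "\<lambda>i\<in>I. f B i ((t(j := B)) i)"
        have "?s \<in> PiE I (F(j := {B}))"
          using t j by (auto simp: PiE_iff extensional_def)
        then have "?z \<in> S" by (rule selection_in[OF f[OF B(1)]])
        moreover have "?z \<in> PiE I t"
        proof (rule PiE_I)
          fix i assume i: "i \<in> I"
          show "?z i \<in> t i"
            using i selection_mem[OF f[OF B(1)] i, of "t i"] PiE_mem[OF t i] B(2)
            by (auto simp: b_def)
        qed simp
        ultimately show "S \<inter> PiE I t \<noteq> {}" by auto
      qed
    qed (auto simp: elementary_def is_singleton_def)
    then obtain g where g: "selection I S ?G g" ..
    have gj: "g j {b B} = b B" if "B \<in> F j" for B
      using g that j unfolding selection_def by auto
    have "(\<lambda>i\<in>I. (g(j := b)) i (t i)) \<in> S" if t: "t \<in> PiE I F" for t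
    proof -
      have tj: "t j \<in> F j" using t j by (auto simp: PiE_iff)
      have "t(j := {b (t j)}) \<in> PiE I ?G"
        using t j by (auto simp: PiE_iff extensional_def)
      then have "(\<lambda>i\<in>I. g i ((t(j := {b (t j)})) i)) \<in> S" by (rule selection_in[OF g])
      moreover have "(\<lambda>i\<in>I. g i ((t(j := {b (t j)})) i)) = (\<lambda>i\<in>I. (g(j := b)) i (t i))"
        using gj[OF tj] by (auto simp: fun_eq_iff)
      ultimately show ?thesis by simp
    qed
    moreover have "(g(j := b)) i B \<in> B" if "i \<in> I" "B \<in> F i" for i B
      using that g b unfolding selection_def by auto
    ultimately have "selection I S F (g(j := b))" by (simp add: selection_def)
    then show ?thesis by blast
  qed
qed

lemma ample_iff_minimax:
  assumes "finite I" "\<forall>i\<in>I. finite (U i)"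
  shows "ample I U S \<longleftrightarrow> minimax I U S"
proof
  assume "minimax I U S"
  then show "ample I U S"
    unfolding ample_def
    using minimax_selection[OF assms(1)] strongly_shattered_iff_selection
      MProd_partial_partitions partial_partitions_def by metis
qed (rule ample_minimax[OF assms])

text \<open>Extends \<open>upper_set\<close> to families that need not partition the factors, such
  as partial partitions.\<close>

definition inside :: "'i set \<Rightarrow> ('i \<Rightarrow> 'a) set \<Rightarrow> ('i \<Rightarrow> 'a set set) \<Rightarrow> ('i \<Rightarrow> 'a set) set" where
  "inside I S F = {t \<in> PiE I F. PiE I t \<subseteq> S}"

lemma upper_set_inside:
  assumes "M \<in> MProd I U" "S \<subseteq> PiE I U"
  shows "upper_set I U S M = inside I S M"
  by (simp add: upper_set_eq[OF assms] inside_def minor_subproduct_def)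

lemma inside_extensional: "inside I S F \<subseteq> extensional I"
  by (auto simp: inside_def PiE_def)

lemma PiE_sub:
  assumes "\<And>i. i \<in> I \<Longrightarrow> s i \<subseteq> t i" "PiE I t \<subseteq> S"
  shows "PiE I s \<subseteq> S"
  using PiE_mono[of I s t] assms by blast

lemma insideI: "t \<in> PiE I F \<Longrightarrow> PiE I t \<subseteq> S \<Longrightarrow> t \<in> inside I S F"
  by (simp add: inside_def)

lemma set_families_PiE_subset:
  assumes "set_families I U F" "t \<in> PiE I F"
  shows "PiE I t \<subseteq> PiE I U"
proof (rule PiE_mono)
  fix i assume i: "i \<in> I"
  show "t i \<subseteq> U i" using assms(1) i PiE_mem[OF assms(2) i] by (auto simp: set_families_def)
qed

section \<open>Isometry\<close>

lemma hamming_dist_eq_0: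
  assumes "finite I" "x \<in> extensional I" "y \<in> extensional I"
  shows "hamming_dist I x y = 0 \<longleftrightarrow> x = y"
  using assms by (auto simp: hamming_dist_def intro: extensionalityI)

lemma hamming_dist_triangle:
  assumes "finite I"
  shows "hamming_dist I x z \<le> hamming_dist I x y + hamming_dist I y z"
proof -
  have "{i\<in>I. x i \<noteq> z i} \<subseteq> {i\<in>I. x i \<noteq> y i} \<union> {i\<in>I. y i \<noteq> z i}" by auto
  then have "card {i\<in>I. x i \<noteq> z i} \<le> card ({i\<in>I. x i \<noteq> y i} \<union> {i\<in>I. y i \<noteq> z i})"
    using assms by (intro card_mono) auto
  also have "\<dots> \<le> card {i\<in>I. x i \<noteq> y i} + card {i\<in>I. y i \<noteq> z i}" by (rule card_Un_le)
  finally show ?thesis by (simp add: hamming_dist_def)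
qed

lemma hamming_dist_eq_1:
  "hamming_dist I x y = 1 \<longleftrightarrow> (\<exists>i\<in>I. x i \<noteq> y i \<and> (\<forall>k\<in>I - {i}. x k = y k))"
proof -
  have "hamming_dist I x y = 1 \<longleftrightarrow> (\<exists>i. {k\<in>I. x k \<noteq> y k} = {i})"
    by (simp add: hamming_dist_def card_1_singleton_iff)
  then show ?thesis by (auto simp: set_eq_iff)
qed

lemma hamming_path_append:
  assumes "hamming_path I p" "hamming_path I q" "last p = hd q"
  shows "hamming_path I (p @ tl q)"
proof (cases q)
  case (Cons a q')
  then show ?thesis using assms
    by (cases q') (auto simp: hamming_path_def successively_append_iff)
qed (use assms in \<open>simp add: hamming_path_def\<close>)

lemma hamming_path_dist:
  assumes "finite I" "hamming_path I p"
  shows "hamming_dist I (hd p) (last p) \<le> length p - 1"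
  using assms(2)
proof (induction p rule: induct_list012)
  case (3 a b p)
  then have "hamming_path I (b # p)" "hamming_dist I a b = 1"
    by (auto simp: hamming_path_def)
  then have "hamming_dist I b (last (b # p)) \<le> length p" using 3 by simp
  then show ?case
    using hamming_dist_triangle[OF assms(1), of a "last (b # p)" b] \<open>hamming_dist I a b = 1\<close>
    by simp
qed (auto simp: hamming_path_def hamming_dist_def)

text \<open>After the first step to \<open>c\<close> the rest of the path is too short unless
  \<open>c\<close> is closer to the end. Hence the coordinate changed by this step must already take
  its final value.\<close>

lemma geodesic_first_step:
  assumes "finite I" "hamming_path I p" "length p - 1 = hamming_dist I (hd p) (last p)"
    "hamming_dist I (hd p) (last p) \<noteq> 0"
  obtains c i where "c \<in> set p" "i \<in> I" "hd p i \<noteq> last p i" "c i = last p i"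
    "\<And>k. k \<in> I - {i} \<Longrightarrow> c k = hd p k"
proof -
  from assms(2-4) obtain a c q where p: "p = a # c # q"
    by (cases p rule: remdups_adj.cases) (auto simp: hamming_path_def)
  let ?b = "last (c # q)"
  have q: "hamming_path I (c # q)" and ac: "hamming_dist I a c = 1"
    using assms(2) p by (auto simp: hamming_path_def)
  from ac obtain i where i: "i \<in> I" "a i \<noteq> c i" "\<forall>k\<in>I - {i}. a k = c k"
    unfolding hamming_dist_eq_1 by blast
  have len: "hamming_dist I a ?b = Suc (length q)" using assms(3) p by simp
  have cb: "hamming_dist I c ?b \<le> length q" using hamming_path_dist[OF assms(1) q] by simp
  have step: "a i \<noteq> ?b i \<and> c i = ?b i"
  proof (rule ccontr)
    assume neg: "\<not> ?thesis"
    have "{k\<in>I. a k \<noteq> ?b k} \<subseteq> {k\<in>I. c k \<noteq> ?b k}"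
    proof
      fix k assume k: "k \<in> {k\<in>I. a k \<noteq> ?b k}"
      show "k \<in> {k\<in>I. c k \<noteq> ?b k}"
        using k i neg by (cases "k = i") auto
    qed
    then have "hamming_dist I a ?b \<le> hamming_dist I c ?b"
      unfolding hamming_dist_def using assms(1) by (intro card_mono) auto
    then show False using len cb by simp
  qed
  show thesis by (rule that[of c i]) (use p i step in auto)
qed

text \<open>A point of \<open>T\<close> strictly between \<open>x\<close> and \<open>y\<close>
  splits their distance into two smaller ones, so geodesics can be concatenated by induction on the
  distance.\<close>

lemma hamming_isometricI:
  assumes "finite I" "T \<subseteq> extensional I"
    and mid: "\<And>x y. x \<in> T \<Longrightarrow> y \<in> T \<Longrightarrow> hamming_dist I x y \<ge> 2 \<Longrightarrow>
      \<exists>z\<in>T. z \<noteq> x \<and> z \<noteq> y \<and> (\<forall>i\<in>I. z i = x i \<or> z i = y i)"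
  shows "hamming_isometric I T"
proof -
  have "\<exists>p. hamming_path I p \<and> set p \<subseteq> T \<and> hd p = x \<and> last p = y \<and>
      length p - 1 = hamming_dist I x y" if "x \<in> T" "y \<in> T" for x y
    using that
  proof (induction "hamming_dist I x y" arbitrary: x y rule: less_induct)
    case less
    have ext: "t \<in> extensional I" if "t \<in> T" for t using assms(2) that by blast
    consider "hamming_dist I x y = 0" | "hamming_dist I x y = 1" | "hamming_dist I x y \<ge> 2"
      by linarith
    then show ?case
    proof cases
      case 1
      then have "x = y" using hamming_dist_eq_0[OF assms(1)] ext less.prems by blast
      then show ?thesis using 1 less.prems by (intro exI[of _ "[x]"]) (auto simp: hamming_path_def)
    next
      case 2
      then show ?thesis using less.prems
        by (intro exI[of _ "[x, y]"]) (auto simp: hamming_path_def)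
    next
      case 3
      then obtain z where z: "z \<in> T" "z \<noteq> x" "z \<noteq> y" "\<forall>i\<in>I. z i = x i \<or> z i = y i"
        using mid less.prems by blast
      \<comment> \<open>Since \<open>z\<close> agrees with \<open>x\<close> or with \<open>y\<close>
        at each coordinate, the coordinates that separate \<open>x\<close> from \<open>y\<close>
        split disjointly into those separating \<open>x\<close> from \<open>z\<close> and those
        separating \<open>z\<close> from \<open>y\<close>.\<close>
      have "x i \<noteq> y i \<longleftrightarrow> x i \<noteq> z i \<or> z i \<noteq> y i" "x i = z i \<or> z i = y i" if "i \<in> I" for i
        using z(4) that by metis+
      then have "{i\<in>I. x i \<noteq> y i} = {i\<in>I. x i \<noteq> z i} \<union> {i\<in>I. z i \<noteq> y i}"
        "{i\<in>I. x i \<noteq> z i} \<inter> {i\<in>I. z i \<noteq> y i} = {}" by blast+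
      then have sum: "hamming_dist I x y = hamming_dist I x z + hamming_dist I z y"
        using assms(1) by (simp add: hamming_dist_def card_Un_disjoint)
      have pos: "hamming_dist I x z \<noteq> 0" "hamming_dist I z y \<noteq> 0"
        using hamming_dist_eq_0[OF assms(1)] ext less.prems z by metis+
      obtain p where p: "hamming_path I p" "set p \<subseteq> T" "hd p = x" "last p = z"
        "length p - 1 = hamming_dist I x z"
        using less.hyps[of x z] sum pos less.prems(1) z(1) by (metis less_add_same_cancel1 neq0_conv)
      obtain q where q: "hamming_path I q" "set q \<subseteq> T" "hd q = z" "last q = y"
        "length q - 1 = hamming_dist I z y"
        using less.hyps[of z y] sum pos less.prems(2) z(1) by (metis less_add_same_cancel2 neq0_conv)
      have "tl q \<noteq> []" using q(5) pos(2) by (metis length_tl list.size(3))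
      then have ne: "p \<noteq> []" "tl q \<noteq> []" "q \<noteq> []"
        using p(1) q(1) unfolding hamming_path_def by simp_all
      then have "hd (p @ tl q) = x" "last (p @ tl q) = y"
        using p q by (simp_all add: last_tl)
      moreover have "set (p @ tl q) \<subseteq> T" using p(2) q(2) ne by (auto dest: list.set_sel(2))
      \<comment> \<open>Dropping the repeated vertex \<open>z\<close> makes the numbers of edges add
        up.\<close>
      moreover have "length (p @ tl q) - 1 = hamming_dist I x y"
        using p(5) q(5) sum ne(1) by (cases p) auto
      moreover have "hamming_path I (p @ tl q)" by (rule hamming_path_append) (use p q in auto)
      ultimately show ?thesis by blast
    qed
  qed
  then show ?thesis unfolding hamming_isometric_def by blast
qed

text \<open>Duality: consider the family \<open>G\<close> with the single set
  \<open>x j \<union> y j\<close> at \<open>j\<close> and \<open>{x k, y k}\<close> elsewhere. A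
  selection for the complement of \<open>S\<close> would pick at \<open>j\<close> a point of
  \<open>x j\<close> or of \<open>y j\<close>, and so produce a point outside \<open>S\<close> in
  the box of \<open>x\<close> or of \<open>y\<close>. Hence the complement does not shatter
  \<open>G\<close>, and the box \<open>s\<close> that it misses lies in \<open>S\<close>.\<close>

lemma inside_exchange:
  assumes I: "finite I" and mm: "minimax I U S" and F: "set_families I U F"
    and x: "x \<in> inside I S F" and y: "y \<in> inside I S F" and j: "j \<in> I"
  obtains s where "\<And>k. k \<in> I - {j} \<Longrightarrow> s k = x k \<or> s k = y k"
    "s(j := x j) \<in> inside I S F" "s(j := y j) \<in> inside I S F"
proof -
  have xF: "x \<in> PiE I F" "PiE I x \<subseteq> S" and yF: "y \<in> PiE I F" "PiE I y \<subseteq> S"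
    using x y by (auto simp: inside_def)
  define G where "G = (\<lambda>k. if k = j then {x j \<union> y j} else {x k, y k})"
  have xG: "x(j := x j \<union> y j) \<in> PiE I G" and yG: "y(j := x j \<union> y j) \<in> PiE I G"
    using xF yF j by (auto simp: G_def PiE_iff extensional_def)
  have memF: "x k \<in> F k" "y k \<in> F k" if "k \<in> I" for k
    using PiE_mem[OF xF(1) that] PiE_mem[OF yF(1) that] .
  have "B \<subseteq> U k \<and> B \<noteq> {}" if "k \<in> I" "B \<in> F k" for k B
    using F that unfolding set_families_def by blast
  with memF have "x k \<subseteq> U k \<and> x k \<noteq> {} \<and> y k \<subseteq> U k \<and> y k \<noteq> {}" if "k \<in> I" for k
    using that by simp
  then have G: "set_families I U G" unfolding set_families_def G_def by simp
  have "\<not> selection I (PiE I U - S) G f" for f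
  proof
    assume f: "selection I (PiE I U - S) G f"
    have no: "f j (x j \<union> y j) \<notin> t j" if t: "t \<in> PiE I F" "PiE I t \<subseteq> S"
      "t(j := x j \<union> y j) \<in> PiE I G" for t
    proof
      assume fj: "f j (x j \<union> y j) \<in> t j"
      let ?z = "\<lambda>i\<in>I. f i ((t(j := x j \<union> y j)) i)"
      have "?z \<in> PiE I t"
      proof (rule PiE_I)
        fix i assume i: "i \<in> I"
        show "?z i \<in> t i"
          using i fj selection_mem[OF f i] PiE_mem[OF t(3) i] by (cases "i = j") auto
      qed simp
      then have "?z \<in> S" using t(2) by blast
      then show False using selection_in[OF f t(3)] by simp
    qed
    have "f j (x j \<union> y j) \<in> x j \<union> y j"
      by (rule selection_mem[OF f j]) (simp add: G_def)
    then show False using no[OF xF xG] no[OF yF yG] by blast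
  qed
  then have "\<not> shattered I (PiE I U - S) G"
    using minimax_selection[OF I minimax_complement[OF mm] G] by blast
  then obtain s where s: "s \<in> PiE I G" "(PiE I U - S) \<inter> PiE I s = {}"
    unfolding shattered_PiE by blast
  have sS: "PiE I s \<subseteq> S" using set_families_PiE_subset[OF G s(1)] s(2) by blast
  have sk: "s k = x k \<or> s k = y k" if "k \<in> I - {j}" for k
    using PiE_mem[OF s(1), of k] that by (simp add: G_def)
  have sj: "s j = x j \<union> y j" using PiE_mem[OF s(1) j] by (simp add: G_def)
  \<comment> \<open>Narrowing the side \<open>x j \<union> y j\<close> of \<open>s\<close> keeps the
    box inside \<open>S\<close>.\<close>
  have "s(j := B) \<in> inside I S F" if B: "B \<in> F j" "B \<subseteq> x j \<union> y j" for B
  proof (rule insideI)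
    show "s(j := B) \<in> PiE I F"
    proof (rule PiE_I)
      fix i assume i: "i \<in> I"
      show "(s(j := B)) i \<in> F i" using B(1) i sk[of i] memF[OF i] by auto
    qed (use s(1) j in \<open>auto simp: PiE_iff extensional_def\<close>)
    show "PiE I (s(j := B)) \<subseteq> S"
      by (rule PiE_sub[OF _ sS]) (use B sj in auto)
  qed
  then show thesis using that[OF sk] memF[OF j] by blast
qed

text \<open>Take two coordinates \<open>j\<close> and \<open>k\<close> at which \<open>x\<close> and
  \<open>y\<close> differ. The tuple \<open>s\<close> of \<open>inside_exchange\<close> follows
  \<open>x\<close> or \<open>y\<close> at \<open>k\<close>; giving it the \<open>j\<close>-th side
  of the other one makes it differ from both.\<close>

lemma minimax_isometric:
  assumes "finite I" "minimax I U S" "set_families I U F"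
  shows "hamming_isometric I (inside I S F)"
proof (rule hamming_isometricI[OF assms(1) inside_extensional])
  fix x y assume xy: "x \<in> inside I S F" "y \<in> inside I S F" and d: "hamming_dist I x y \<ge> 2"
  let ?D = "{i\<in>I. x i \<noteq> y i}"
  have card: "card ?D \<ge> 2" using d by (simp add: hamming_dist_def)
  then have "?D \<noteq> {}" by (intro notI) simp
  then obtain j where j: "j \<in> ?D" by blast
  have "card (?D - {j}) \<noteq> 0" using card j assms(1) by (simp add: card_Diff_singleton)
  then have "?D - {j} \<noteq> {}" by (intro notI) (simp only: card.empty)
  then obtain k where k: "k \<in> ?D - {j}" by blast
  obtain s where s: "\<And>k. k \<in> I - {j} \<Longrightarrow> s k = x k \<or> s k = y k"
    "s(j := x j) \<in> inside I S F" "s(j := y j) \<in> inside I S F"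
    using inside_exchange[OF assms xy, of j] j by auto
  show "\<exists>z\<in>inside I S F. z \<noteq> x \<and> z \<noteq> y \<and> (\<forall>i\<in>I. z i = x i \<or> z i = y i)"
  proof (cases "s k = x k")
    case True
    have "(s(j := y j)) j \<noteq> x j" "(s(j := y j)) k \<noteq> y k" using True j k by auto
    then have "s(j := y j) \<noteq> x" "s(j := y j) \<noteq> y" by metis+
    then show ?thesis using s by (intro bexI[of _ "s(j := y j)"]) auto
  next
    case False
    have "(s(j := x j)) j \<noteq> y j" "(s(j := x j)) k \<noteq> x k" using False j k by auto
    then have "s(j := x j) \<noteq> x" "s(j := x j) \<noteq> y" by metis+
    then show ?thesis using s by (intro bexI[of _ "s(j := x j)"]) auto
  qed
qed

lemma hamming_isometric_connected: "hamming_isometric I T \<Longrightarrow> hamming_connected I T"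
  unfolding hamming_isometric_def hamming_connected_def by blast

section \<open>Connectedness\<close>

text \<open>Adjacency within \<open>T\<close> as a relation, so that paths can be followed by
  induction on its reflexive transitive closure.\<close>

definition hamming_edges :: "'i set \<Rightarrow> ('i \<Rightarrow> 'b) set \<Rightarrow> (('i \<Rightarrow> 'b) \<times> ('i \<Rightarrow> 'b)) set" where
  "hamming_edges I T = {(x, y). x \<in> T \<and> y \<in> T \<and> hamming_dist I x y = 1}"

lemma hamming_path_rtrancl:
  assumes "hamming_path I p" "set p \<subseteq> T"
  shows "(hd p, last p) \<in> (hamming_edges I T)\<^sup>*"
  using assms
proof (induction p rule: induct_list012)
  case (3 a b p)
  then have "(a, b) \<in> hamming_edges I T" "(b, last (b # p)) \<in> (hamming_edges I T)\<^sup>*"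
    by (auto simp: hamming_path_def hamming_edges_def)
  then show ?case by (simp add: converse_rtrancl_into_rtrancl)
qed (auto simp: hamming_path_def)

lemma hamming_connected_rtrancl:
  assumes "hamming_connected I T" "x \<in> T" "y \<in> T"
  shows "(x, y) \<in> (hamming_edges I T)\<^sup>*"
proof -
  obtain p where "hamming_path I p" "set p \<subseteq> T" "hd p = x" "last p = y"
    using assms unfolding hamming_connected_def by blast
  then show ?thesis using hamming_path_rtrancl by blast
qed

lemma rtrancl_exit:
  assumes "(x, y) \<in> r\<^sup>*" "P x" "\<not> P y"
  obtains a b where "(a, b) \<in> r" "P a" "\<not> P b"
  using assms by (induction rule: rtrancl_induct) blast+

lemma PiE_fun_upd_mem:
  assumes "z \<in> PiE I (t(j := Q))" "z j \<in> P"
  shows "z \<in> PiE I (t(j := P))"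
proof (rule PiE_I)
  fix i assume i: "i \<in> I"
  show "z i \<in> (t(j := P)) i" using PiE_mem[OF assms(1) i] assms(2) by (cases "i = j") auto
qed (use assms(1) in \<open>auto simp: PiE_iff extensional_def\<close>)

text \<open>Given two boxes in \<open>inside I S F\<close> whose \<open>j\<close>-th side may be replaced by the uncovered point \<open>u\<close>,
  merging \<open>u\<close> into the \<open>j\<close>-th side \<open>P\<close> of the first one yields a path, and replacing the merged
  side by \<open>P\<close> along it yields a path that avoids \<open>u\<close>.\<close>

lemma inside_detour:
  assumes F: "partial_partitions I U F" and j: "j \<in> I" and u: "u \<notin> \<Union> (F j)"
    and conn: "\<And>P x y. \<lbrakk>P \<in> F j; x \<in> inside I S (F(j := insert (insert u P) (F j - {P})));
        y \<in> inside I S (F(j := insert (insert u P) (F j - {P})))\<rbrakk> \<Longrightarrow>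
        (x, y) \<in> (hamming_edges I (inside I S (F(j := insert (insert u P) (F j - {P})))))\<^sup>*"
    and a: "a \<in> inside I S F" "PiE I (a(j := {u})) \<subseteq> S"
    and b: "b \<in> inside I S F" "PiE I (b(j := {u})) \<subseteq> S"
  shows "(a, b) \<in> (hamming_edges I (inside I S F))\<^sup>*"
proof -
  have aF: "a \<in> PiE I F" "PiE I a \<subseteq> S" and bF: "b \<in> PiE I F" "PiE I b \<subseteq> S"
    using a(1) b(1) by (auto simp: inside_def)
  define P where "P = a j"
  define Q where "Q = insert u P"
  define H where "H = F(j := insert Q (F j - {P}))"
  define \<phi> where "\<phi> = (\<lambda>t. if t j = Q then t(j := P) else t)"
  have P: "P \<in> F j" using PiE_mem[OF aF(1) j] by (simp add: P_def)
  have Q: "Q \<notin> F j" using u by (auto simp: Q_def)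
  have merge: "t(j := Q) \<in> inside I S H"
    if t: "t \<in> PiE I F" "PiE I t \<subseteq> S" "PiE I (t(j := {u})) \<subseteq> S" "t j = P" for t
  proof (rule insideI)
    show "t(j := Q) \<in> PiE I H"
      using t(1) j by (auto simp: H_def PiE_iff extensional_def)
    show "PiE I (t(j := Q)) \<subseteq> S"
    proof
      fix z assume z: "z \<in> PiE I (t(j := Q))"
      then have "z j \<in> Q" using PiE_mem[OF z j] by simp
      then consider "z j \<in> P" | "z j = u" by (auto simp: Q_def)
      then show "z \<in> S"
      proof cases
        case 1
        then have "z \<in> PiE I (t(j := P))" by (rule PiE_fun_upd_mem[OF z])
        then have "z \<in> PiE I t" by (simp flip: t(4))
        then show ?thesis using t(2) by blast
      next
        case 2
        then have "z \<in> PiE I (t(j := {u}))" by (intro PiE_fun_upd_mem[OF z]) simp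
        then show ?thesis using t(3) by blast
      qed
    qed
  qed
  have \<phi>_in: "\<phi> t \<in> inside I S F" if "t \<in> inside I S H" for t
  proof (rule insideI)
    have t: "t \<in> PiE I H" "PiE I t \<subseteq> S" using that by (auto simp: inside_def)
    show "\<phi> t \<in> PiE I F"
    proof (rule PiE_I)
      fix i assume i: "i \<in> I"
      show "\<phi> t i \<in> F i" using PiE_mem[OF t(1) i] P by (auto simp: \<phi>_def H_def)
    qed (use t(1) j in \<open>auto simp: PiE_iff extensional_def \<phi>_def\<close>)
    show "PiE I (\<phi> t) \<subseteq> S" by (rule PiE_sub[OF _ t(2)]) (auto simp: \<phi>_def Q_def)
  qed
  have \<phi>_edge: "(\<phi> s, \<phi> t) \<in> hamming_edges I (inside I S F)"
    if "(s, t) \<in> hamming_edges I (inside I S H)" for s t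
  proof -
    have st: "s \<in> inside I S H" "t \<in> inside I S H" "hamming_dist I s t = 1"
      using that by (auto simp: hamming_edges_def)
    \<comment> \<open>\<open>P\<close> is no longer a block of \<open>H\<close> at \<open>j\<close>,
      so \<open>\<phi>\<close> identifies no two tuples of \<open>inside I S H\<close> at any
      coordinate and preserves adjacency.\<close>
    have "t' j = Q \<or> t' j \<noteq> P" if "t' \<in> inside I S H" for t'
      using that PiE_mem[of t' I H j] j by (auto simp: inside_def H_def)
    with st have "\<phi> s i = \<phi> t i \<longleftrightarrow> s i = t i" for i
      by (auto simp: \<phi>_def)
    then have "hamming_dist I (\<phi> s) (\<phi> t) = hamming_dist I s t"
      by (simp add: hamming_dist_def)
    then show ?thesis using st \<phi>_in by (simp add: hamming_edges_def)
  qed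
  \<comment> \<open>If the block of \<open>b\<close> at \<open>j\<close> is not \<open>P\<close>,
    then \<open>b\<close> already is a tuple of \<open>H\<close>.\<close>
  define b' where "b' = (if b j = P then b(j := Q) else b)"
  have a': "a(j := Q) \<in> inside I S H" using merge[OF aF a(2)] by (simp add: P_def)
  have b': "b' \<in> inside I S H"
  proof (cases "b j = P")
    case True
    then show ?thesis using merge[OF bF b(2)] by (simp add: b'_def)
  next
    case False
    then have "b \<in> PiE I H" using bF(1) by (auto simp: H_def PiE_iff)
    then show ?thesis using False bF(2) by (simp add: b'_def inside_def)
  qed
  have "(a(j := Q), b') \<in> (hamming_edges I (inside I S H))\<^sup>*"
    using conn[OF P] a' b' by (simp add: H_def Q_def)
  then have "(\<phi> (a(j := Q)), \<phi> b') \<in> (hamming_edges I (inside I S F))\<^sup>*"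
  proof (induction rule: rtrancl_induct)
    case (step s t)
    then show ?case using \<phi>_edge[OF step(2)] by simp
  qed simp
  moreover have "\<phi> (a(j := Q)) = a" by (simp add: \<phi>_def P_def)
  moreover have "b j \<noteq> Q" using Q PiE_mem[OF bF(1) j] by metis
  then have "\<phi> b' = b" by (auto simp: \<phi>_def b'_def)
  ultimately show ?thesis by simp
qed

text \<open>A path from \<open>x\<close> to \<open>y\<close> exists once \<open>{u}\<close> is made
  a block. Each stretch of it with \<open>{u}\<close> at coordinate \<open>j\<close> is entered and
  left by edges in direction \<open>j\<close>, so the vertices just before and just after it satisfy
  the hypotheses of \<open>inside_detour\<close>, and the stretch can be bypassed.\<close>

lemma inside_connected:
  assumes "finite I" "\<forall>i\<in>I. finite (U i)" "S \<subseteq> PiE I U"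
    and conn: "\<forall>M\<in>MProd I U. hamming_connected I (upper_set I U S M)"
    and F: "partial_partitions I U F"
  shows "x \<in> inside I S F \<Longrightarrow> y \<in> inside I S F \<Longrightarrow>
    (x, y) \<in> (hamming_edges I (inside I S F))\<^sup>*"
  using assms(1,2,5)
proof (induction arbitrary: x y rule: partial_partitions_induct)
  case (total F)
  have "inside I S (restrict F I) = inside I S F"
    by (simp add: inside_def cong: PiE_cong)
  then show ?case
    using hamming_connected_rtrancl[of I "inside I S F"] conn total upper_set_inside[OF total(1) assms(3)]
    by auto
next
  case (step F j u)
  define N where "N = inside I S (F(j := insert {u} (F j)))"
  define T where "T = inside I S F"
  have TN: "w \<in> T \<longleftrightarrow> w \<in> N \<and> w j \<noteq> {u}" for w
  proof -
    have "w \<in> PiE I F \<longleftrightarrow> w \<in> PiE I (F(j := insert {u} (F j))) \<and> w j \<noteq> {u}"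
      using step(2,4) by (auto simp: PiE_iff)
    then show ?thesis by (auto simp: T_def N_def inside_def)
  qed
  have NS: "PiE I w \<subseteq> S" "w \<in> extensional I" if "w \<in> N" for w
    using that by (auto simp: N_def inside_def PiE_def)
  have detour: "(a, b) \<in> (hamming_edges I T)\<^sup>*"
    if "a \<in> T" "b \<in> T" "PiE I (a(j := {u})) \<subseteq> S" "PiE I (b(j := {u})) \<subseteq> S" for a b
    unfolding T_def
    by (rule inside_detour[OF step(1,2,4)], rule step(6), assumption+)
      (use that in \<open>simp_all add: T_def\<close>)
  have xy: "x \<in> T" "y \<in> T" using step.prems by (auto simp: T_def)
  \<comment> \<open>An edge along which coordinate \<open>j\<close> changes leaves all other
    coordinates fixed.\<close>
  have swap: "z(j := w j) = w" if zw: "z \<in> N" "w \<in> N" "hamming_dist I z w = 1" "z j \<noteq> w j" for z w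
  proof -
    obtain i where "\<forall>k\<in>I - {i}. z k = w k" using zw(3) unfolding hamming_dist_eq_1 by blast
    then have "\<forall>k\<in>I - {j}. z k = w k" using zw(4) step(2) by (cases "i = j") blast+
    then have "(z(j := w j)) k = w k" for k
      using NS(2)[OF zw(1)] NS(2)[OF zw(2)] by (cases "k \<in> I") (auto simp: extensional_def)
    then show ?thesis by blast
  qed
  have "x \<in> N" "y \<in> N" using TN xy by blast+
  then have "(x, y) \<in> (hamming_edges I N)\<^sup>*" unfolding N_def by (rule step(5))
  \<comment> \<open>Invariant along the path in \<open>N\<close>: a current vertex in
    \<open>T\<close> is reached inside \<open>T\<close>. While the path is in the slice of
    \<open>u\<close>, some \<open>a\<close> reached inside \<open>T\<close> is remembered whose
    \<open>j\<close>-th side may be replaced by \<open>{u}\<close>; the detour starts from it when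
    the path returns to \<open>T\<close>.\<close>
  then have "(y \<in> T \<longrightarrow> (x, y) \<in> (hamming_edges I T)\<^sup>*) \<and>
    (y \<notin> T \<longrightarrow> (\<exists>a\<in>T. (x, a) \<in> (hamming_edges I T)\<^sup>* \<and> PiE I (a(j := {u})) \<subseteq> S))"
  proof (induction rule: rtrancl_induct)
    case base
    then show ?case using xy by simp
  next
    case (step z w)
    have zw: "z \<in> N" "w \<in> N" "hamming_dist I z w = 1"
      using step(2) by (auto simp: hamming_edges_def)
    consider "z \<in> T" "w \<in> T" | "z \<in> T" "w \<notin> T" | "z \<notin> T" "w \<in> T" | "z \<notin> T" "w \<notin> T" by blast
    then show ?case
    proof cases
      case 1
      then have "(z, w) \<in> hamming_edges I T" using zw by (simp add: hamming_edges_def)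
      then show ?thesis using 1 step.IH by (meson rtrancl.rtrancl_into_rtrancl)
    next
      case 2
      then have "w j = {u}" "z j \<noteq> {u}" using TN zw by blast+
      then have "PiE I (z(j := {u})) \<subseteq> S" using swap[OF zw] NS(1)[OF zw(2)] by simp
      then show ?thesis using 2 step.IH by blast
    next
      case 3
      then obtain a where a: "a \<in> T" "(x, a) \<in> (hamming_edges I T)\<^sup>*" "PiE I (a(j := {u})) \<subseteq> S"
        using step.IH by blast
      have zu: "z j = {u}" "w j \<noteq> {u}" using 3 TN zw by blast+
      have "hamming_dist I w z = 1" using zw(3) by (simp add: hamming_dist_def eq_commute)
      then have "w(j := {u}) = z" using swap[OF zw(2,1)] zu by simp
      then have "PiE I (w(j := {u})) \<subseteq> S" using NS(1)[OF zw(1)] by simp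
      then have "(a, w) \<in> (hamming_edges I T)\<^sup>*" using detour a 3 by blast
      then show ?thesis using a(2) 3 by (meson rtrancl_trans)
    next
      case 4
      then show ?thesis using step.IH by blast
    qed
  qed
  then show ?case using xy(2) by (simp add: T_def)
qed

section \<open>Boxes over \<open>A\<close> and the splitting of one side\<close>

lemma box_times_subset_iff:
  assumes "y \<in> extensional I" "\<And>i. i \<in> I - A \<Longrightarrow> y i \<in> V i"
  shows "PiE I (box_times I A V y) \<subseteq> S \<longleftrightarrow> (\<forall>x\<in>PiE I V. override_on y x A \<in> S)"
proof
  assume sub: "PiE I (box_times I A V y) \<subseteq> S"
  have "override_on y x A \<in> PiE I (box_times I A V y)" if "x \<in> PiE I V" for x
    using that assms by (auto simp: override_on_def box_times_def PiE_iff extensional_def)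
  then show "\<forall>x\<in>PiE I V. override_on y x A \<in> S" using sub by blast
next
  assume H: "\<forall>x\<in>PiE I V. override_on y x A \<in> S"
  show "PiE I (box_times I A V y) \<subseteq> S"
  proof
    fix z assume z: "z \<in> PiE I (box_times I A V y)"
    have zi: "(if i \<in> A then z i \<in> V i else z i = y i)" if "i \<in> I" for i
      using PiE_mem[OF z that] that by (auto simp: box_times_def)
    have "z \<in> PiE I V"
    proof (rule PiE_I)
      fix i assume i: "i \<in> I"
      show "z i \<in> V i" using zi[OF i] assms(2)[of i] i by (auto split: if_splits)
    qed (use z in \<open>auto simp: PiE_iff extensional_def\<close>)
    moreover have "override_on y z A = z"
    proof
      fix i
      show "override_on y z A i = z i"
        using zi[of i] z assms(1)
        by (cases "i \<in> I") (auto simp: override_on_def PiE_iff extensional_def)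
    qed
    ultimately show "z \<in> S" using bspec[OF H, of z] by simp
  qed
qed

text \<open>Induction on the total size of the sides over \<open>A\<close>. If all of them are
  singletons, all \<open>x\<close> agree on \<open>A\<close> and a single \<open>y\<close> serves.
  Otherwise a side \<open>V j\<close> is cut into \<open>P\<close> and \<open>{v}\<close>, both
  parts have boxes in \<open>S\<close> by induction, and \<open>split\<close> has to merge
  them.\<close>

lemma minimaxI_split:
  assumes I: "finite I" and U: "\<forall>i\<in>I. finite (U i)"
    and split: "\<And>A V j v P y y'. \<lbrakk>A \<subseteq> I; \<forall>i\<in>I. V i \<subseteq> U i \<and> V i \<noteq> {}; j \<in> A; V j = insert v P;
      v \<notin> P; P \<noteq> {}; y \<in> PiE I V; y' \<in> PiE I V;
      PiE I (box_times I A (V(j := P)) y) \<subseteq> S; PiE I (box_times I A (V(j := {v})) y') \<subseteq> S\<rbrakk>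
      \<Longrightarrow> \<exists>y\<in>PiE I V. PiE I (box_times I A V y) \<subseteq> S"
  shows "minimax I U S"
proof -
  \<comment> \<open>The points of this box are exactly the tuples \<open>override_on y x A\<close>,
    so the conclusion of \<open>minimax\<close> asks for a box inside \<open>S\<close>.\<close>
  have bt: "PiE I (box_times I A V y) \<subseteq> S \<longleftrightarrow> (\<forall>x\<in>PiE I V. override_on y x A \<in> S)"
    if "y \<in> PiE I V" for A V and y :: "'a \<Rightarrow> 'b"
    by (rule box_times_subset_iff) (use that in \<open>auto simp: PiE_iff\<close>)
  have main: "\<exists>y\<in>PiE I V. PiE I (box_times I A V y) \<subseteq> S"
    if "A \<subseteq> I" "\<forall>i\<in>I. V i \<subseteq> U i \<and> V i \<noteq> {}"
      "\<forall>x\<in>PiE I V. \<exists>y\<in>PiE I V. override_on y x A \<in> S" for A V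
    using that
  proof (induction "\<Sum>i\<in>A. card (V i)" arbitrary: V rule: less_induct)
    case less
    show ?case
    proof (cases "\<forall>i\<in>A. is_singleton (V i)")
      case True
      obtain x0 where x0: "x0 \<in> PiE I V"
        using less.prems(2) by (metis PiE_eq_empty_iff ex_in_conv)
      then obtain y where y: "y \<in> PiE I V" "override_on y x0 A \<in> S" using less.prems(3) by blast
      have "override_on y x A = override_on y x0 A" if x: "x \<in> PiE I V" for x
      proof -
        have "x i = x0 i" if "i \<in> A" for i
        proof -
          obtain a where "V i = {a}" using True \<open>i \<in> A\<close> by (auto simp: is_singleton_def)
          moreover have "i \<in> I" using \<open>i \<in> A\<close> less.prems(1) by blast
          ultimately show ?thesis using PiE_mem[OF x, of i] PiE_mem[OF x0, of i] by simp
        qed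
        then show ?thesis by (auto simp: override_on_def)
      qed
      then have "PiE I (box_times I A V y) \<subseteq> S" unfolding bt[OF y(1)] using y(2) by simp
      then show ?thesis using y(1) by blast
    next
      case False
      then obtain j where j: "j \<in> A" "\<not> is_singleton (V j)" by blast
      have jI: "j \<in> I" using j less.prems(1) by blast
      then obtain v where v: "v \<in> V j" using less.prems(2) by blast
      define P where "P = V j - {v}"
      have "P \<noteq> {}" using v j(2) by (auto simp: P_def is_singleton_def)
      have part: "\<exists>y\<in>PiE I V. PiE I (box_times I A (V(j := Q)) y) \<subseteq> S"
        if Q: "Q \<subset> V j" "Q \<noteq> {}" for Q
      proof -
        have fin: "finite (V i)" if "i \<in> I" for i
          using U less.prems(2) that by (meson finite_subset)
        have "PiE I (V(j := Q)) \<subseteq> PiE I V" by (rule PiE_mono) (use Q(1) in auto)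
        then have mem: "x \<in> PiE I V" if "x \<in> PiE I (V(j := Q))" for x using that by blast
        have "\<exists>y\<in>PiE I (V(j := Q)). PiE I (box_times I A (V(j := Q)) y) \<subseteq> S"
        proof (rule less.hyps)
          show "(\<Sum>i\<in>A. card ((V(j := Q)) i)) < (\<Sum>i\<in>A. card (V i))"
          proof (rule sum_strict_mono_ex1)
            show "finite A" using less.prems(1) I by (rule finite_subset)
            have "card Q < card (V j)" using Q(1) fin[OF jI] by (intro psubset_card_mono)
            then show "\<exists>i\<in>A. card ((V(j := Q)) i) < card (V i)"
              "\<forall>i\<in>A. card ((V(j := Q)) i) \<le> card (V i)" using j(1) by auto
          qed
          show "\<forall>i\<in>I. (V(j := Q)) i \<subseteq> U i \<and> (V(j := Q)) i \<noteq> {}"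
            using less.prems(2) Q by auto
          show "\<forall>x\<in>PiE I (V(j := Q)). \<exists>y\<in>PiE I (V(j := Q)). override_on y x A \<in> S"
          proof
            fix x assume x: "x \<in> PiE I (V(j := Q))"
            then obtain y where y: "y \<in> PiE I V" "override_on y x A \<in> S"
              using less.prems(3) mem by blast
            \<comment> \<open>As \<open>j\<close> lies in \<open>A\<close>, the value of
              \<open>y\<close> there is overridden and can be moved into \<open>Q\<close>.\<close>
            have "y(j := x j) \<in> PiE I (V(j := Q))"
              using y(1) jI PiE_mem[OF x jI] by (auto simp: PiE_iff extensional_def)
            moreover have "override_on (y(j := x j)) x A = override_on y x A"
              using j(1) by (auto simp: override_on_def)
            ultimately show "\<exists>y\<in>PiE I (V(j := Q)). override_on y x A \<in> S"
              using y(2) by metis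
          qed
        qed (rule less.prems(1))
        then show ?thesis using mem by blast
      qed
      obtain y where y: "y \<in> PiE I V" "PiE I (box_times I A (V(j := P)) y) \<subseteq> S"
        using part[of P] v \<open>P \<noteq> {}\<close> by (auto simp: P_def)
      obtain y' where y': "y' \<in> PiE I V" "PiE I (box_times I A (V(j := {v})) y') \<subseteq> S"
        using part[of "{v}"] v \<open>P \<noteq> {}\<close> by (auto simp: P_def)
      show ?thesis
        by (rule split[OF less.prems(1,2) j(1) _ _ _ y(1) y'(1) y(2) y'(2)])
           (use v \<open>P \<noteq> {}\<close> in \<open>auto simp: P_def\<close>)
    qed
  qed
  show ?thesis
    unfolding minimax_def
  proof (intro allI impI, elim conjE)
    fix A V
    assume "A \<subseteq> I" "\<forall>i\<in>I. V i \<subseteq> U i \<and> V i \<noteq> {}"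
      "\<forall>x\<in>PiE I V. \<exists>y\<in>PiE I V. override_on y x A \<in> S"
    then show "\<exists>y\<in>PiE I V. \<forall>x\<in>PiE I V. override_on y x A \<in> S"
      using main[of A V] bt by (simp cong: bex_cong)
  qed
qed

lemma box_times_mono:
  assumes "\<And>i. i \<in> A \<Longrightarrow> V i \<subseteq> W i" "PiE I (box_times I A W y) \<subseteq> S"
  shows "PiE I (box_times I A V y) \<subseteq> S"
  by (rule PiE_sub[OF _ assms(2)]) (use assms(1) in \<open>auto simp: box_times_def\<close>)

text \<open>The points of \<open>P\<close> are treated separately because box-superisometry delivers
  the boxes with sides \<open>{p}\<close> one at a time.\<close>

lemma box_times_join:
  assumes "j \<in> A" "j \<in> I" "V j = insert v P"
    and "PiE I (box_times I A (V(j := {v})) y) \<subseteq> S" "\<And>p. p \<in> P \<Longrightarrow> PiE I (box_times I A (V(j := {p})) y) \<subseteq> S"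
  shows "PiE I (box_times I A V y) \<subseteq> S"
proof
  fix z assume z: "z \<in> PiE I (box_times I A V y)"
  have "z j \<in> insert v P" using PiE_mem[OF z assms(2)] assms(1-3) by (simp add: box_times_def)
  then have "PiE I (box_times I A (V(j := {z j})) y) \<subseteq> S" using assms(4,5) by blast
  moreover have "z \<in> PiE I ((box_times I A V y)(j := {z j}))"
    by (rule PiE_fun_upd_mem[where Q = "box_times I A V y j"]) (use z in simp_all)
  moreover have "(box_times I A V y)(j := {z j}) = box_times I A (V(j := {z j})) y"
    using assms(1,2) by (auto simp: box_times_def fun_eq_iff)
  ultimately show "z \<in> S" by auto
qed

text \<open>The box with side \<open>P\<close> and the box with side \<open>{v}\<close> are joined
  by a path. The edge at which \<open>P\<close> is left changes only coordinate \<open>j\<close>, so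
  its ends share a tuple \<open>z\<close> off \<open>A\<close> and together fill the box with side
  \<open>V j\<close>.\<close>

lemma superconnected_minimax:
  assumes I: "finite I" and U: "\<forall>i\<in>I. finite (U i)" and S: "S \<subseteq> PiE I U"
    and conn: "\<forall>M\<in>MProd I U. hamming_connected I (upper_set I U S M)"
  shows "minimax I U S"
proof (rule minimaxI_split[OF I U])
  fix A V j v P y y'
  assume A: "A \<subseteq> I" and V: "\<forall>i\<in>I. V i \<subseteq> U i \<and> V i \<noteq> {}" and j: "j \<in> A" and Vj: "V j = insert v P"
    and vP: "v \<notin> P" "P \<noteq> {}" and y: "y \<in> PiE I V" and y': "y' \<in> PiE I V"
    and bP: "PiE I (box_times I A (V(j := P)) y) \<subseteq> S"
    and bv: "PiE I (box_times I A (V(j := {v})) y') \<subseteq> S"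
  have jI: "j \<in> I" using j A by blast
  \<comment> \<open>The sides over \<open>A\<close> other than the \<open>j\<close>-th are frozen,
    and those off \<open>A\<close> are points; a path can only switch between \<open>P\<close> and
    \<open>{v}\<close> or move the tuple off \<open>A\<close>.\<close>
  define F where "F = (\<lambda>i. if i = j then {P, {v}} else if i \<in> A then {V i} else (\<lambda>a. {a}) ` V i)"
  have FA: "F j = {P, {v}}" "i \<in> A \<Longrightarrow> i \<noteq> j \<Longrightarrow> F i = {V i}"
    "i \<notin> A \<Longrightarrow> F i = (\<lambda>a. {a}) ` V i" for i
    using j by (auto simp: F_def)
  have F: "partial_partitions I U F"
    unfolding partial_partitions_def set_families_def
  proof (intro conjI ballI)
    fix i assume i: "i \<in> I"
    consider "i = j" | "i \<in> A" "i \<noteq> j" | "i \<notin> A" by blast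
    then have "F i \<subseteq> Pow (U i) - {{}} \<and> disjoint (F i)"
    proof cases
      case 1
      then show ?thesis using V i Vj vP FA(1) by (auto simp: disjoint_def)
    next
      case 2
      then show ?thesis using V i FA(2) by (auto simp: disjoint_def)
    next
      case 3
      then show ?thesis using V i FA(3) by (auto simp: disjoint_def)
    qed
    then show "F i \<subseteq> Pow (U i) - {{}}" "disjoint (F i)" by blast+
  qed
  have mem: "box_times I A (V(j := Q)) z \<in> inside I S F"
    if "z \<in> PiE I V" "Q \<in> {P, {v}}" "PiE I (box_times I A (V(j := Q)) z) \<subseteq> S" for z Q
  proof (rule insideI)
    show "box_times I A (V(j := Q)) z \<in> PiE I F"
    proof (rule PiE_I)
      fix i assume i: "i \<in> I"
      show "box_times I A (V(j := Q)) z i \<in> F i"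
        using i that(2) PiE_mem[OF that(1) i] by (auto simp: box_times_def F_def j)
    qed (simp add: box_times_def)
  qed (rule that(3))
  let ?x = "box_times I A (V(j := P)) y" and ?x' = "box_times I A (V(j := {v})) y'"
  have "(?x, ?x') \<in> (hamming_edges I (inside I S F))\<^sup>*"
    by (rule inside_connected[OF I U S conn F]) (use mem y y' bP bv in auto)
  moreover have "?x j = P" "?x' j \<noteq> P" using j jI vP by (auto simp: box_times_def)
  ultimately obtain a b where ab: "(a, b) \<in> hamming_edges I (inside I S F)" "a j = P" "b j \<noteq> P"
    using rtrancl_exit[of ?x ?x' _ "\<lambda>t. t j = P"] by blast
  then have a: "a \<in> PiE I F" "PiE I a \<subseteq> S" and b: "b \<in> PiE I F" "PiE I b \<subseteq> S"
    by (auto simp: hamming_edges_def inside_def)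
  have bj: "b j = {v}" using PiE_mem[OF b(1) jI] ab(3) FA(1) by simp
  obtain i where "\<forall>k\<in>I - {i}. a k = b k" "i \<in> I"
    using ab(1) unfolding hamming_edges_def hamming_dist_eq_1 by auto
  then have agree: "a k = b k" if "k \<in> I - {j}" for k
    using ab(2,3) jI that by (cases "i = j") auto
  \<comment> \<open>Over \<open>A\<close> the values are borrowed from \<open>y\<close> to make
    \<open>z\<close> a point of \<open>PiE I V\<close>; off \<open>A\<close> they are read off the
    singleton sides of \<open>a\<close>.\<close>
  define z where "z = (\<lambda>i\<in>I. if i \<in> A then y i else the_elem (a i))"
  have off: "a i = {z i} \<and> z i \<in> V i" if i: "i \<in> I - A" for i
  proof -
    have "a i \<in> (\<lambda>a. {a}) ` V i" using PiE_mem[OF a(1), of i] FA(3)[of i] i by simp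
    then obtain c where c: "c \<in> V i" "a i = {c}" by blast
    moreover have "z i = c" using i c(2) by (simp add: z_def)
    ultimately show ?thesis by simp
  qed
  have on: "a i = V i" if i: "i \<in> A" "i \<noteq> j" for i
    using PiE_mem[OF a(1), of i] FA(2)[of i] i A by auto
  have eq: "t = box_times I A (V(j := Q)) z"
    if t: "t \<in> PiE I F" "t j = Q" "\<And>k. k \<in> I - {j} \<Longrightarrow> t k = a k" for t Q
  proof
    fix i
    consider "i \<notin> I" | "i = j" | "i \<in> A" "i \<noteq> j" | "i \<in> I - A" by blast
    then show "t i = box_times I A (V(j := Q)) z i"
    proof cases
      case 1
      then show ?thesis using PiE_arb[OF t(1)] by (simp add: box_times_def)
    next
      case 2
      then show ?thesis using t(2) j jI by (simp add: box_times_def)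
    next
      case 3
      then show ?thesis using t(3)[of i] on[of i] A by (auto simp: box_times_def)
    next
      case 4
      then have "i \<noteq> j" using j by blast
      then show ?thesis using t(3)[of i] off[OF 4] 4 by (simp add: box_times_def)
    qed
  qed
  have aeq: "a = box_times I A (V(j := P)) z" by (rule eq[OF a(1) ab(2)]) simp
  have beq: "b = box_times I A (V(j := {v})) z" by (rule eq[OF b(1) bj]) (simp add: agree)
  have "PiE I (box_times I A V z) \<subseteq> S"
  proof (rule box_times_join[where V = V, OF j jI Vj])
    show "PiE I (box_times I A (V(j := {v})) z) \<subseteq> S" using b(2) beq by simp
    show "PiE I (box_times I A (V(j := {p})) z) \<subseteq> S" if "p \<in> P" for p
      by (rule box_times_mono[where W = "V(j := P)"]) (use that a(2) aeq in auto)
  qed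
  moreover have "z \<in> PiE I V"
  proof (rule PiE_I)
    fix i assume i: "i \<in> I"
    show "z i \<in> V i"
      using off[of i] PiE_mem[OF y i] i by (cases "i \<in> A") (auto simp: z_def)
  qed (simp add: z_def)
  ultimately show "\<exists>y\<in>PiE I V. PiE I (box_times I A V y) \<subseteq> S" by blast
qed

section \<open>Box-superisometry\<close>

text \<open>The first step of a geodesic gallery from \<open>B\<close> to \<open>B'\<close> gives
  one side its final value.\<close>

lemma box_superisometric_step:
  assumes I: "finite I" and bs: "box_superisometric I U S"
    and B: "B \<in> boxes I U" "B' \<in> boxes I U" "parallel I B B'" "PiE I B \<subseteq> S" "PiE I B' \<subseteq> S" "B \<noteq> B'"
  obtains i where "i \<in> I" "B i \<noteq> B' i" "PiE I (B(i := B' i)) \<subseteq> S"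
proof -
  obtain A V ts where gal: "geodesic_gallery I U A V ts B B'"
    and sub: "\<And>t. t \<in> set ts \<Longrightarrow> PiE I (box_times I A V t) \<subseteq> S"
    using bs B(1-5) unfolding box_superisometric_def by blast
  have g: "A \<subseteq> I" "set ts \<subseteq> PiE (I - A) U" "hamming_path (I - A) ts"
    "B = box_times I A V (hd ts)" "B' = box_times I A V (last ts)"
    "length ts - 1 = hamming_dist (I - A) (hd ts) (last ts)"
    using gal by (auto simp: geodesic_gallery_def)
  have "hamming_dist (I - A) (hd ts) (last ts) \<noteq> 0"
  proof
    assume "hamming_dist (I - A) (hd ts) (last ts) = 0"
    then have "\<forall>i\<in>I - A. hd ts i = last ts i" using I by (auto simp: hamming_dist_def)
    then have "B = B'" unfolding g(4,5) by (auto simp: box_times_def fun_eq_iff)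
    then show False using B(6) by simp
  qed
  from geodesic_first_step[OF _ g(3,6) this] I obtain c i where c: "c \<in> set ts" "i \<in> I - A"
    "hd ts i \<noteq> last ts i" "c i = last ts i" "\<And>k. k \<in> I - A - {i} \<Longrightarrow> c k = hd ts k"
    by (metis finite_Diff)
  have "B(i := B' i) = box_times I A V c"
    using c(2,4,5) unfolding g(4,5) by (auto simp: box_times_def fun_eq_iff)
  then show thesis
    using that[of i] sub[OF c(1)] c(2,3) by (auto simp: g(4,5) box_times_def)
qed

text \<open>Among the tuples \<open>w\<close> whose box with side \<open>{v}\<close> lies in
  \<open>S\<close>, one nearest to \<open>y\<close> off \<open>A\<close> is taken. A gallery step
  from this box towards the box of \<open>y\<close> with side \<open>{p}\<close> must change side
  \<open>j\<close>, since any other step would bring \<open>w\<close> nearer to \<open>y\<close>.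
  Thus the same \<open>w\<close> serves every \<open>p\<close> in \<open>P\<close>.\<close>

lemma box_superisometric_minimax:
  assumes I: "finite I" and U: "\<forall>i\<in>I. finite (U i)" and bs: "box_superisometric I U S"
  shows "minimax I U S"
proof (rule minimaxI_split[OF I U])
  fix A V j v P y y'
  assume A: "A \<subseteq> I" and V: "\<forall>i\<in>I. V i \<subseteq> U i \<and> V i \<noteq> {}" and j: "j \<in> A" and Vj: "V j = insert v P"
    and vP: "v \<notin> P" "P \<noteq> {}" and y: "y \<in> PiE I V" and y': "y' \<in> PiE I V"
    and bP: "PiE I (box_times I A (V(j := P)) y) \<subseteq> S"
    and bv: "PiE I (box_times I A (V(j := {v})) y') \<subseteq> S"
  have jI: "j \<in> I" using j A by blast
  define good where "good = (\<lambda>w. w \<in> PiE I V \<and> PiE I (box_times I A (V(j := {v})) w) \<subseteq> S)"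
  have "good y'" using y' bv by (simp add: good_def)
  then obtain w where w: "good w"
    and least: "\<And>w'. good w' \<Longrightarrow> hamming_dist (I - A) w y \<le> hamming_dist (I - A) w' y"
    using ex_has_least_nat[of good y' "\<lambda>w. hamming_dist (I - A) w y"] by blast
  have wV: "w \<in> PiE I V" and wS: "PiE I (box_times I A (V(j := {v})) w) \<subseteq> S"
    using w by (auto simp: good_def)
  have box: "box_times I A (V(j := {p})) z \<in> boxes I U" if "p \<in> V j" "z \<in> PiE I V" for p z
    unfolding boxes_def
  proof (rule PiE_I)
    fix i assume i: "i \<in> I"
    show "box_times I A (V(j := {p})) z i \<in> Pow (U i) - {{}}"
      using V i that(1) PiE_mem[OF that(2) i] by (auto simp: box_times_def)
  qed (simp add: box_times_def)
  \<comment> \<open>Parallel boxes may differ only in singleton sides, so \<open>P\<close> is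
    replaced by its points.\<close>
  have "PiE I (box_times I A (V(j := {p})) w) \<subseteq> S" if p: "p \<in> P" for p
  proof -
    let ?B = "box_times I A (V(j := {v})) w" and ?B' = "box_times I A (V(j := {p})) y"
    have "PiE I ?B' \<subseteq> S"
      by (rule box_times_mono[OF _ bP]) (use p in auto)
    moreover have "parallel I ?B ?B'" by (auto simp: parallel_def box_times_def)
    moreover have "?B j = {v}" "?B' j = {p}" using j jI by (auto simp: box_times_def)
    then have "?B \<noteq> ?B'" using p vP by auto
    ultimately obtain i where i: "i \<in> I" "?B i \<noteq> ?B' i" "PiE I (?B(i := ?B' i)) \<subseteq> S"
      using box_superisometric_step[OF I bs box box _ wS] wV y Vj p
      by (metis insert_iff)
    show ?thesis
    proof (cases "i = j")
      case True
      then have "?B(i := ?B' i) = box_times I A (V(j := {p})) w"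
        using j jI by (auto simp: box_times_def fun_eq_iff)
      then show ?thesis using i(3) by simp
    next
      case False
      then have iA: "i \<in> I - A" "w i \<noteq> y i" using i by (auto simp: box_times_def split: if_splits)
      have "?B(i := ?B' i) = box_times I A (V(j := {v})) (w(i := y i))"
        using iA by (auto simp: box_times_def fun_eq_iff)
      moreover have "w(i := y i) \<in> PiE I V"
        using wV PiE_mem[OF y i(1)] i(1) by (auto simp: PiE_iff extensional_def)
      ultimately have "good (w(i := y i))" using i(3) by (simp add: good_def)
      then have "hamming_dist (I - A) w y \<le> hamming_dist (I - A) (w(i := y i)) y" by (rule least)
      moreover have "hamming_dist (I - A) (w(i := y i)) y < hamming_dist (I - A) w y"
        unfolding hamming_dist_def by (rule psubset_card_mono) (use iA I in auto)
      ultimately show ?thesis by simp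
    qed
  qed
  then have "PiE I (box_times I A V w) \<subseteq> S" by (intro box_times_join[where V = V, OF j jI Vj wS])
  then show "\<exists>y\<in>PiE I V. PiE I (box_times I A V y) \<subseteq> S" using wV by blast
qed

text \<open>A geodesic in \<open>inside I S F\<close> is already a gallery if \<open>F\<close>
  freezes the common sides of \<open>B\<close> and \<open>B'\<close> and consists of singletons
  elsewhere; parallelism puts both boxes among the tuples of \<open>F\<close>.\<close>

lemma minimax_box_superisometric:
  assumes I: "finite I" and mm: "minimax I U S"
  shows "box_superisometric I U S"
  unfolding box_superisometric_def
proof (intro ballI impI, elim conjE)
  fix B B' assume B: "B \<in> boxes I U" "B' \<in> boxes I U" and par: "parallel I B B'"
    and sub: "PiE I B \<subseteq> S" "PiE I B' \<subseteq> S"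
  define A where "A = {i\<in>I. B i = B' i}"
  define F where "F = (\<lambda>i. if i \<in> A then {B i} else (\<lambda>a. {a}) ` U i)"
  have A: "A \<subseteq> I" by (auto simp: A_def)
  have BU: "B i \<subseteq> U i" "B i \<noteq> {}" "B' i \<subseteq> U i" if "i \<in> I" for i
    using B that by (auto simp: boxes_def PiE_iff)
  have F: "set_families I U F" using BU by (auto simp: set_families_def F_def)
  have off: "B i \<in> F i \<and> B' i \<in> F i" if i: "i \<in> I" for i
  proof (cases "i \<in> A")
    case False
    then have "card (B i) = 1" "card (B' i) = 1" using par i by (auto simp: parallel_def A_def)
    then obtain b b' where "B i = {b}" "B' i = {b'}" by (auto simp: card_1_singleton_iff)
    then show ?thesis using False BU[OF i] by (auto simp: F_def)
  qed (simp add: F_def A_def)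
  have ext: "B \<in> extensional I" "B' \<in> extensional I" using B by (auto simp: boxes_def PiE_iff)
  have "B \<in> inside I S F" "B' \<in> inside I S F"
    using off ext sub by (auto simp: inside_def PiE_iff)
  then obtain p where p: "hamming_path I p" "set p \<subseteq> inside I S F" "hd p = B" "last p = B'"
    "length p - 1 = hamming_dist I B B'"
    using minimax_isometric[OF I mm F] unfolding hamming_isometric_def by blast
  \<comment> \<open>Translates a tuple of sides into the point tuple off \<open>A\<close>. Over
    \<open>A\<close> every tuple of \<open>F\<close> has the sides of \<open>B\<close>, so nothing
    is lost and distances are preserved.\<close>
  define \<tau> where "\<tau> = (\<lambda>t. \<lambda>i\<in>I - A. the_elem (t i :: 'b set))"
  have pF: "t \<in> PiE I F" "PiE I t \<subseteq> S" if "t \<in> set p" for t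
    using p(2) that by (auto simp: inside_def)
  have bt: "box_times I A (restrict B A) (\<tau> t) = t" if t: "t \<in> PiE I F" for t
  proof
    fix i show "box_times I A (restrict B A) (\<tau> t) i = t i"
    proof (cases "i \<in> I")
      case True
      show ?thesis
      proof (cases "i \<in> A")
        case False
        then obtain a where "t i = {a}" using PiE_mem[OF t True] by (auto simp: F_def)
        then show ?thesis using True False by (simp add: box_times_def \<tau>_def)
      qed (use True PiE_mem[OF t True] in \<open>simp add: F_def box_times_def\<close>)
    next
      case False
      then show ?thesis using PiE_arb[OF t] by (simp add: box_times_def)
    qed
  qed
  have dist: "hamming_dist (I - A) (\<tau> s) (\<tau> t) = hamming_dist I s t"
    if s: "s \<in> PiE I F" and t: "t \<in> PiE I F" for s t
  proof -
    have "i \<in> I - A \<and> \<tau> s i \<noteq> \<tau> t i \<longleftrightarrow> i \<in> I \<and> s i \<noteq> t i" for i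
    proof (cases "i \<in> I")
      case True
      show ?thesis
      proof (cases "i \<in> A")
        case False
        then obtain a b where "s i = {a}" "t i = {b}"
          using PiE_mem[OF s True] PiE_mem[OF t True] by (auto simp: F_def)
        then show ?thesis using True False by (simp add: \<tau>_def)
      qed (use PiE_mem[OF s True] PiE_mem[OF t True] in \<open>simp add: F_def\<close>)
    qed simp
    then show ?thesis by (simp add: hamming_dist_def)
  qed
  have pne: "p \<noteq> []" using p(1) by (simp add: hamming_path_def)
  have "successively (\<lambda>x y. hamming_dist (I - A) (\<tau> x) (\<tau> y) = 1) p"
    using p(1) unfolding hamming_path_def
    by (elim conjE, rule_tac successively_mono) (use dist pF in auto)
  then have "hamming_path (I - A) (map \<tau> p)"
    using pne by (simp add: hamming_path_def successively_map)
  moreover have "set (map \<tau> p) \<subseteq> PiE (I - A) U"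
  proof -
    have "\<tau> t \<in> PiE (I - A) U" if "t \<in> set p" for t
    proof (rule PiE_I)
      fix i assume i: "i \<in> I - A"
      then show "\<tau> t i \<in> U i" using PiE_mem[OF pF(1)[OF that], of i] by (auto simp: F_def \<tau>_def)
    qed (auto simp: \<tau>_def)
    then show ?thesis by auto
  qed
  moreover have "restrict B A \<in> boxes A U"
    using BU subsetD[OF A] by (auto simp: boxes_def PiE_iff subset_iff)
  moreover have BF: "B \<in> PiE I F" "B' \<in> PiE I F"
    using pF(1)[of "hd p"] pF(1)[of "last p"] pne p(3,4) by auto
  ultimately have "geodesic_gallery I U A (restrict B A) (map \<tau> p) B B'"
    unfolding geodesic_gallery_def
    using A pne p(3-5) bt dist by (simp add: hd_map last_map)
  moreover have "\<forall>t\<in>set (map \<tau> p). PiE I (box_times I A (restrict B A) t) \<subseteq> S"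
    using bt pF by auto
  ultimately show "\<exists>A V ts. geodesic_gallery I U A V ts B B' \<and>
      (\<forall>t\<in>set ts. PiE I (box_times I A V t) \<subseteq> S)" by blast
qed

section \<open>Commutativity\<close>

lemma partition_join_singletons:
  assumes "partition_on A \<alpha>"
  shows "partition_join A \<alpha> ((\<lambda>x. {x}) ` A) = \<alpha>"
    and "partition_join A ((\<lambda>x. {x}) ` A) \<alpha> = \<alpha>"
proof -
  \<comment> \<open>A one-point index set turns the known statement on generalized partitions into
    one on a single partition.\<close>
  have "(\<lambda>i\<in>{()}. \<alpha>) \<in> MProd {()} (\<lambda>_. A)" using assms by (simp add: MProd_def PiE_iff)
  from fun_cong[OF minor_join_singleton_partition[OF this], of "()"]
  show "partition_join A \<alpha> ((\<lambda>x. {x}) ` A) = \<alpha>"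
    by (simp add: minor_join_def singleton_partition_def)
  then show "partition_join A ((\<lambda>x. {x}) ` A) \<alpha> = \<alpha>"
    by (simp add: partition_join_def is_finest_common_coarsening_def conj_ac)
qed

definition singletons_on :: "'i set \<Rightarrow> ('i \<Rightarrow> 'a set) \<Rightarrow> ('i \<Rightarrow> 'a set set) \<Rightarrow> bool" where
  "singletons_on A U M \<longleftrightarrow> (\<forall>i\<in>A. M i = (\<lambda>x. {x}) ` U i)"

lemma partition_on_block: "partition_on A \<alpha> \<Longrightarrow> B \<in> \<alpha> \<Longrightarrow> B \<subseteq> A \<and> B \<noteq> {}"
  by (auto simp: partition_on_def)

lemma partition_on_singletons:
  assumes "partition_on A \<alpha>" "\<forall>B\<in>\<alpha>. is_singleton B"
  shows "\<alpha> = (\<lambda>x. {x}) ` A"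
proof (intro set_eqI iffI)
  fix B assume "B \<in> \<alpha>"
  moreover from this obtain x where "B = {x}" using assms(2) by (auto simp: is_singleton_def)
  ultimately show "B \<in> (\<lambda>x. {x}) ` A" using assms(1) by (auto simp: partition_on_def)
next
  fix B assume "B \<in> (\<lambda>x. {x}) ` A"
  then obtain x where x: "B = {x}" "x \<in> A" by blast
  then obtain C where "C \<in> \<alpha>" "x \<in> C" using assms(1) by (auto simp: partition_on_def)
  moreover from this obtain y where "C = {y}" using assms(2) by (auto simp: is_singleton_def)
  ultimately show "B \<in> \<alpha>" using x by auto
qed

lemma singletons_on_iff_support:
  assumes "M \<in> MProd I U" "A \<subseteq> I"
  shows "singletons_on A U M \<longleftrightarrow> support I M \<inter> A = {}"
proof
  assume "singletons_on A U M"
  then show "support I M \<inter> A = {}"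
    by (auto simp: singletons_on_def support_def is_singleton_def)
next
  assume H: "support I M \<inter> A = {}"
  show "singletons_on A U M"
    unfolding singletons_on_def
  proof
    fix i assume i: "i \<in> A"
    then have "partition_on (U i) (M i)" using assms by (auto simp: MProd_def PiE_iff)
    moreover have "\<forall>B\<in>M i. is_singleton B" using H i assms(2) by (auto simp: support_def)
    ultimately show "M i = (\<lambda>x. {x}) ` U i" by (rule partition_on_singletons)
  qed
qed

text \<open>At each coordinate one of the two partitions consists of singletons, so the join is the
  other one.\<close>

lemma minor_join_complementary:
  assumes "M \<in> MProd I U" "M' \<in> MProd I U" "A \<subseteq> I"
    and "singletons_on A U M'" "singletons_on (I - A) U M"
  shows "minor_join I U M M' = (\<lambda>i\<in>I. if i \<in> A then M i else M' i)"
    and "minor_join I U M' M = (\<lambda>i\<in>I. if i \<in> A then M i else M' i)"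
proof -
  have p: "partition_on (U i) (M i)" "partition_on (U i) (M' i)" if "i \<in> I" for i
    using assms(1,2) that by (auto simp: MProd_def PiE_iff)
  have "partition_join (U i) (M i) (M' i) = (if i \<in> A then M i else M' i)"
    "partition_join (U i) (M' i) (M i) = (if i \<in> A then M i else M' i)" if i: "i \<in> I" for i
    using assms(4,5) i partition_join_singletons[OF p(1)[OF i]] partition_join_singletons[OF p(2)[OF i]]
    by (simp_all add: singletons_on_def)
  then show "minor_join I U M M' = (\<lambda>i\<in>I. if i \<in> A then M i else M' i)"
    "minor_join I U M' M = (\<lambda>i\<in>I. if i \<in> A then M i else M' i)"
    by (simp_all add: minor_join_def cong: restrict_cong)
qed

text \<open>Blocks are nonempty, so inclusion of boxes is inclusion in each coordinate.\<close>

lemma fibre_iff: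
  assumes "M \<in> MProd I U"
  shows "s \<in> fibre I M t \<longleftrightarrow> s \<in> PiE I M \<and> (\<forall>i\<in>I. s i \<subseteq> t i)"
proof -
  have "s i \<noteq> {}" if "s \<in> PiE I M" "i \<in> I" for i
    using PiE_mem[OF that] assms that(2) by (auto simp: MProd_def PiE_iff partition_on_def)
  then show ?thesis
    by (auto simp: fibre_def minor_subproduct_def subset_PiE PiE_eq_empty_iff)
qed

lemma partition_on_subset_eq:
  assumes "partition_on A \<alpha>" "B \<in> \<alpha>" "C \<in> \<alpha>" "B \<subseteq> C"
  shows "B = C"
proof -
  have "B \<noteq> {}" using assms(1,2) by (auto simp: partition_on_def)
  then show ?thesis using assms unfolding partition_on_def disjoint_def by blast
qed

text \<open>Over \<open>A\<close> a block of \<open>M\<close> contained in the block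
  \<open>t i\<close> equals it; elsewhere the blocks are singletons. An element of the fibre is
  therefore given by a point of the box of \<open>t\<close>.\<close>

lemma fibre_complementary:
  assumes M: "M \<in> MProd I U" and A: "A \<subseteq> I" "singletons_on (I - A) U M"
    and t: "t \<in> extensional I" "\<And>i. i \<in> I \<Longrightarrow> t i \<subseteq> U i" "\<And>i. i \<in> A \<Longrightarrow> t i \<in> M i"
  shows "fibre I M t = box_times I A t ` PiE I t"
proof (intro set_eqI iffI)
  fix s assume "s \<in> fibre I M t"
  then have s: "s \<in> PiE I M" "\<And>i. i \<in> I \<Longrightarrow> s i \<subseteq> t i" by (auto simp: fibre_iff[OF M])
  define x where "x = (\<lambda>i\<in>I. SOME a. a \<in> s i)"
  have ne: "s i \<noteq> {}" if "i \<in> I" for i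
    using PiE_mem[OF s(1) that] M that by (auto simp: MProd_def PiE_iff partition_on_def)
  have xs: "x i \<in> s i" if "i \<in> I" for i
    using ne[OF that] that by (simp add: x_def some_in_eq)
  have "x \<in> PiE I t" using xs s(2) by (intro PiE_I) (auto simp: x_def)
  moreover have "s = box_times I A t x"
  proof
    fix i
    consider "i \<notin> I" | "i \<in> A" | "i \<in> I - A" by blast
    then show "s i = box_times I A t x i"
    proof cases
      case 1
      then show ?thesis using PiE_arb[OF s(1)] by (simp add: box_times_def)
    next
      case 2
      then have "i \<in> I" using A(1) by blast
      moreover from this have "partition_on (U i) (M i)" using M by (auto simp: MProd_def PiE_iff)
      ultimately have "s i = t i"
        using partition_on_subset_eq PiE_mem[OF s(1)] t(3)[OF 2] s(2) by metis
      then show ?thesis using 2 \<open>i \<in> I\<close> by (simp add: box_times_def)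
    next
      case 3
      then have "s i \<in> (\<lambda>x. {x}) ` U i" using A(2) PiE_mem[OF s(1), of i] by (simp add: singletons_on_def)
      then obtain a where "s i = {a}" by blast
      then show ?thesis using xs[of i] 3 by (simp add: box_times_def)
    qed
  qed
  ultimately show "s \<in> box_times I A t ` PiE I t" by blast
next
  fix s assume "s \<in> box_times I A t ` PiE I t"
  then obtain x where x: "x \<in> PiE I t" "s = box_times I A t x" by blast
  have "s i \<in> M i \<and> s i \<subseteq> t i" if i: "i \<in> I" for i
  proof (cases "i \<in> A")
    case False
    then show ?thesis
      using A(2) i PiE_mem[OF x(1) i] t(2)[OF i] x(2) by (auto simp: singletons_on_def box_times_def)
  qed (use t(3) i x(2) in \<open>simp add: box_times_def\<close>)
  then show "s \<in> fibre I M t"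
    using x(2) by (auto simp: fibre_iff[OF M] PiE_iff box_times_def)
qed

text \<open>With \<open>M\<close> living on \<open>A\<close> and \<open>M'\<close> off
  \<open>A\<close>, the two sides of the commutativity equation differ only in the order of the
  quantifiers over \<open>x\<close> and \<open>y\<close>: commutativity is the exchange required by
  \<open>minimax\<close>.\<close>

lemma commute_iff:
  assumes S: "S \<subseteq> PiE I U" and M: "M \<in> MProd I U" "M' \<in> MProd I U" and A: "A \<subseteq> I"
    and sing: "singletons_on A U M'" "singletons_on (I - A) U M"
  shows "lower_minor I U M (upper_set I U S M) M' =
      {t \<in> PiE I (\<lambda>i. if i \<in> A then M i else M' i). \<exists>y\<in>PiE I t. \<forall>x\<in>PiE I t. override_on y x A \<in> S}"
    and "upper_minor I U M' (lower_set I U S M') M =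
      {t \<in> PiE I (\<lambda>i. if i \<in> A then M i else M' i). \<forall>x\<in>PiE I t. \<exists>y\<in>PiE I t. override_on y x A \<in> S}"
proof -
  let ?J = "\<lambda>i. if i \<in> A then M i else M' i"
  have J: "PiE I (\<lambda>i\<in>I. ?J i) = PiE I ?J" by (rule PiE_cong) simp
  have part: "partition_on (U i) (M i)" "partition_on (U i) (M' i)" if "i \<in> I" for i
    using M that by (auto simp: MProd_def PiE_iff)
  have tU: "t i \<subseteq> U i" if "t \<in> PiE I ?J" "i \<in> I" for t i
    using PiE_mem[OF that] part[OF that(2)] by (auto simp: partition_on_def split: if_splits)
  have fib: "fibre I M t = box_times I A t ` PiE I t" if t: "t \<in> PiE I ?J" for t
    by (rule fibre_complementary[OF M(1) A sing(2)])
       (use t tU[OF t] A in \<open>force simp: PiE_iff\<close>)+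
  have fib': "fibre I M' t = box_times I (I - A) t ` PiE I t" if t: "t \<in> PiE I ?J" for t
    by (rule fibre_complementary[OF M(2) Diff_subset])
       (use t tU[OF t] A sing(1) in \<open>force simp: PiE_iff double_diff\<close>)+
  have ext: "x \<in> extensional I" if "x \<in> PiE I t" for x and t :: "'a \<Rightarrow> 'b set"
    using that by (simp add: PiE_iff)
  have upper: "box_times I A t y \<in> upper_set I U S M \<longleftrightarrow> (\<forall>x\<in>PiE I t. override_on y x A \<in> S)"
    if t: "t \<in> PiE I ?J" and y: "y \<in> PiE I t" for t y
  proof -
    have "box_times I A t y \<in> PiE I M"
      using fib[OF t] y by (auto simp: fibre_iff[OF M(1)])
    moreover have "PiE I (box_times I A t y) \<subseteq> S \<longleftrightarrow> (\<forall>x\<in>PiE I t. override_on y x A \<in> S)"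
      by (rule box_times_subset_iff) (use y in \<open>auto simp: PiE_iff\<close>)
    ultimately show ?thesis
      by (simp add: upper_set_eq[OF M(1) S] minor_subproduct_def)
  qed
  have lower: "box_times I (I - A) t x \<in> lower_set I U S M' \<longleftrightarrow> (\<exists>y\<in>PiE I t. override_on y x A \<in> S)"
    if t: "t \<in> PiE I ?J" and x: "x \<in> PiE I t" for t x
  proof -
    have "box_times I (I - A) t x \<in> PiE I M'"
      using fib'[OF t] x by (auto simp: fibre_iff[OF M(2)])
    \<comment> \<open>That the box meets \<open>S\<close> is obtained by negating the criterion for
      its inclusion in the complement of \<open>S\<close>.\<close>
    moreover have "PiE I (box_times I (I - A) t x) \<subseteq> - S \<longleftrightarrow>
        (\<forall>y\<in>PiE I t. override_on x y (I - A) \<in> - S)"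
      by (rule box_times_subset_iff) (use x in \<open>auto simp: PiE_iff\<close>)
    then have "PiE I (box_times I (I - A) t x) \<inter> S \<noteq> {} \<longleftrightarrow>
        (\<exists>y\<in>PiE I t. override_on x y (I - A) \<in> S)" by blast
    moreover have "override_on x y (I - A) = override_on y x A" if "y \<in> PiE I t" for y
      using override_on_Diff ext that x by blast
    ultimately show ?thesis
      by (simp add: lower_set_eq[OF M(2) S] minor_subproduct_def cong: bex_cong)
  qed
  have join: "minor_subproduct I (minor_join I U M' M) = PiE I ?J"
    "minor_subproduct I (minor_join I U M M') = PiE I ?J"
    unfolding minor_subproduct_def minor_join_complementary[OF M A sing] by (rule J)+
  have "fibre I M t \<inter> upper_set I U S M \<noteq> {} \<longleftrightarrow>
      (\<exists>y\<in>PiE I t. \<forall>x\<in>PiE I t. override_on y x A \<in> S)" if t: "t \<in> PiE I ?J" for t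
  proof -
    have "fibre I M t \<inter> upper_set I U S M \<noteq> {} \<longleftrightarrow>
        (\<exists>y\<in>PiE I t. box_times I A t y \<in> upper_set I U S M)"
      unfolding fib[OF t] by blast
    then show ?thesis using upper[OF t] by (simp cong: bex_cong)
  qed
  then show "lower_minor I U M (upper_set I U S M) M' =
      {t \<in> PiE I ?J. \<exists>y\<in>PiE I t. \<forall>x\<in>PiE I t. override_on y x A \<in> S}"
    unfolding lower_minor_def join by blast
  have "fibre I M' t \<subseteq> lower_set I U S M' \<longleftrightarrow>
      (\<forall>x\<in>PiE I t. \<exists>y\<in>PiE I t. override_on y x A \<in> S)" if t: "t \<in> PiE I ?J" for t
    unfolding fib'[OF t] image_subset_iff using lower[OF t] by (simp cong: ball_cong)
  then show "upper_minor I U M' (lower_set I U S M') M =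
      {t \<in> PiE I ?J. \<forall>x\<in>PiE I t. \<exists>y\<in>PiE I t. override_on y x A \<in> S}"
    unfolding upper_minor_def join by blast
qed

lemma minimax_commute:
  assumes S: "S \<subseteq> PiE I U" and mm: "minimax I U S"
    and M: "M \<in> MProd I U" "M' \<in> MProd I U" "support I M \<inter> support I M' = {}"
  shows "lower_minor I U M (upper_set I U S M) M' = upper_minor I U M' (lower_set I U S M') M"
proof -
  \<comment> \<open>Off its support \<open>M\<close> consists of singletons; on it \<open>M'\<close>
    does, because the supports are disjoint.\<close>
  define A where "A = support I M"
  have A: "A \<subseteq> I" by (auto simp: A_def support_def)
  have sing: "singletons_on A U M'" "singletons_on (I - A) U M"
    using singletons_on_iff_support[OF M(2) A] singletons_on_iff_support[OF M(1), of "I - A"] M(3)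
    by (auto simp: A_def)
  let ?J = "\<lambda>i. if i \<in> A then M i else M' i"
  have swap: "(\<exists>y\<in>PiE I t. \<forall>x\<in>PiE I t. override_on y x A \<in> S) \<longleftrightarrow>
      (\<forall>x\<in>PiE I t. \<exists>y\<in>PiE I t. override_on y x A \<in> S)" if t: "t \<in> PiE I ?J" for t
  proof
    assume H: "\<forall>x\<in>PiE I t. \<exists>y\<in>PiE I t. override_on y x A \<in> S"
    have side: "t i \<subseteq> U i \<and> t i \<noteq> {}" if i: "i \<in> I" for i
    proof -
      have "partition_on (U i) (M i)" "partition_on (U i) (M' i)"
        using M i by (auto simp: MProd_def PiE_iff)
      then have "partition_on (U i) (?J i)" by simp
      from partition_on_block[OF this PiE_mem[OF t i]] show ?thesis .
    qed
    obtain y where "y \<in> PiE I t" "\<And>x. x \<in> PiE I t \<Longrightarrow> override_on y x A \<in> S"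
      by (rule minimaxD[OF mm A, where V = t]) (simp_all add: side H)
    then show "\<exists>y\<in>PiE I t. \<forall>x\<in>PiE I t. override_on y x A \<in> S" by blast
  qed blast
  show ?thesis
    unfolding commute_iff[OF S M(1,2) A sing]
    by (rule Collect_cong, rule conj_cong[OF refl], rule swap)
qed

lemma Union_Diff_empty: "\<Union> (X - {{}}) = \<Union> X"
  by auto

lemma commute_minimax:
  assumes S: "S \<subseteq> PiE I U"
    and comm: "\<And>M M'. \<lbrakk>M \<in> MProd I U; M' \<in> MProd I U; support I M \<inter> support I M' = {}\<rbrakk> \<Longrightarrow>
      lower_minor I U M (upper_set I U S M) M' = upper_minor I U M' (lower_set I U S M') M"
  shows "minimax I U S"
  unfolding minimax_def
proof (intro allI impI, elim conjE)
  fix A V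
  assume A: "A \<subseteq> I" and V: "\<forall>i\<in>I. V i \<subseteq> U i \<and> V i \<noteq> {}"
    and H: "\<forall>x\<in>PiE I V. \<exists>y\<in>PiE I V. override_on y x A \<in> S"
  \<comment> \<open>The partitions are chosen so that \<open>V\<close> itself is an element of the
    join of \<open>M A\<close> and \<open>M (I - A)\<close>. Removing the empty set covers the case
    \<open>V i = U i\<close>.\<close>
  define M where "M = (\<lambda>C. \<lambda>i\<in>I. if i \<in> C then {V i, U i - V i} - {{}} else (\<lambda>x. {x}) ` U i)"
  have M: "M C \<in> MProd I U" for C
    unfolding MProd_def
  proof (rule PiE_I)
    fix i assume i: "i \<in> I"
    have "V i \<subseteq> U i" using V i by blast
    then have "\<Union> {V i, U i - V i} = U i" by auto
    then have "\<Union> ({V i, U i - V i} - {{}}) = U i" unfolding Union_Diff_empty .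
    moreover have "disjoint ({V i, U i - V i} - {{}})" by (auto simp: disjoint_def)
    ultimately have "partition_on (U i) ({V i, U i - V i} - {{}})" by (simp add: partition_on_def)
    moreover have "partition_on (U i) ((\<lambda>x. {x}) ` U i)"
      by (auto simp: partition_on_def disjoint_def)
    ultimately show "M C i \<in> {\<alpha>. partition_on (U i) \<alpha>}" using i by (simp add: M_def)
  qed (simp add: M_def)
  have sing: "singletons_on A U (M (I - A))" "singletons_on (I - A) U (M A)"
    using A by (auto simp: singletons_on_def M_def)
  have "support I (M A) \<inter> support I (M (I - A)) = {}"
    using sing singletons_on_iff_support[OF M A] singletons_on_iff_support[OF M Diff_subset]
    by (auto simp: support_def)
  note eq = comm[OF M M this, unfolded commute_iff[OF S M M A sing]]
  let ?t = "restrict V I"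
  have PV: "PiE I ?t = PiE I V" by (rule PiE_cong) simp
  have "?t \<in> PiE I (\<lambda>i. if i \<in> A then M A i else M (I - A) i)"
    by (rule PiE_I) (use V in \<open>auto simp: M_def\<close>)
  then have "?t \<in> {t \<in> PiE I (\<lambda>i. if i \<in> A then M A i else M (I - A) i).
      \<forall>x\<in>PiE I t. \<exists>y\<in>PiE I t. override_on y x A \<in> S}"
    using H PV by simp
  then show "\<exists>y\<in>PiE I V. \<forall>x\<in>PiE I V. override_on y x A \<in> S"
    unfolding eq[symmetric] using PV by simp
qed

theorem theorem2:
  fixes m :: nat and U :: "nat \<Rightarrow> 'a set" and S :: "(nat \<Rightarrow> 'a) set"
  assumes fin: "\<And>i. i \<in> {1..m} \<Longrightarrow> finite (U i)"
    and ne: "\<And>i. i \<in> {1..m} \<Longrightarrow> U i \<noteq> {}"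
    and S: "S \<subseteq> PiE {1..m} U"
  shows
    "(ample {1..m} U S \<longleftrightarrow> (\<forall>M\<in>MProd {1..m} U. hamming_isometric {1..m} (upper_set {1..m} U S M))) \<and>
     (ample {1..m} U S \<longleftrightarrow> box_superisometric {1..m} U S) \<and>
     (ample {1..m} U S \<longleftrightarrow> (\<forall>M\<in>MProd {1..m} U. hamming_connected {1..m} (upper_set {1..m} U S M))) \<and>
     (ample {1..m} U S \<longleftrightarrow>
        (\<forall>M\<in>MProd {1..m} U. \<forall>M'\<in>MProd {1..m} U. support {1..m} M \<inter> support {1..m} M' = {} \<longrightarrow>
           lower_minor {1..m} U M (upper_set {1..m} U S M) M' =
           upper_minor {1..m} U M' (lower_set {1..m} U S M') M)) \<and>
     (ample {1..m} U S \<longleftrightarrow> ample {1..m} U (PiE {1..m} U - S))"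
proof -
  let ?I = "{1..m}"
  have I: "finite ?I" by simp
  have U: "\<forall>i\<in>?I. finite (U i)" using fin by blast
  have ample: "ample ?I U T \<longleftrightarrow> minimax ?I U T" for T by (rule ample_iff_minimax[OF I U])
  have isometric: "hamming_isometric ?I (upper_set ?I U S M)" if "minimax ?I U S" "M \<in> MProd ?I U" for M
    unfolding upper_set_inside[OF that(2) S]
    using minimax_isometric[OF I that(1)] MProd_partial_partitions[OF that(2)]
    by (simp add: partial_partitions_def)
  have connected: "minimax ?I U S" if "\<forall>M\<in>MProd ?I U. hamming_connected ?I (upper_set ?I U S M)"
    by (rule superconnected_minimax[OF I U S that])
  \<comment> \<open>Superisometricity and superconnectivity come from one cycle:
    \<open>minimax\<close> gives isometry, isometry gives connectedness, and connectedness of all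
    \<open>S^M\<close> gives \<open>minimax\<close> back.\<close>
  have 2: "minimax ?I U S \<longleftrightarrow> (\<forall>M\<in>MProd ?I U. hamming_isometric ?I (upper_set ?I U S M))"
    using isometric connected hamming_isometric_connected by meson
  have 3: "minimax ?I U S \<longleftrightarrow> box_superisometric ?I U S"
    using minimax_box_superisometric[OF I] box_superisometric_minimax[OF I U] by blast
  have 4: "minimax ?I U S \<longleftrightarrow> (\<forall>M\<in>MProd ?I U. hamming_connected ?I (upper_set ?I U S M))"
    using isometric connected hamming_isometric_connected by meson
  have 5: "minimax ?I U S \<longleftrightarrow>
      (\<forall>M\<in>MProd ?I U. \<forall>M'\<in>MProd ?I U. support ?I M \<inter> support ?I M' = {} \<longrightarrow>
         lower_minor ?I U M (upper_set ?I U S M) M' = upper_minor ?I U M' (lower_set ?I U S M') M)"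
    using minimax_commute[OF S] commute_minimax[OF S] by meson
  have "PiE ?I U - (PiE ?I U - S) = S" using S by blast
  then have 6: "minimax ?I U S \<longleftrightarrow> minimax ?I U (PiE ?I U - S)"
    using minimax_complement[of ?I U S] minimax_complement[of ?I U "PiE ?I U - S"] by metis
  show ?thesis unfolding ample using 2 3 4 5 6 by (intro conjI)
qed

end
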